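(* Let $N\ge 3$ be an integer. The first eigenvalue of the Dirichlet Laplacian in the regular polyhedral layer $\Pi_N^\theta$ satisfies $$\lambda_1(\mathcal{A}^{\Pi_N^\theta})\to\pi^2\qquad\text{as }\theta\to\pi/2,\ \theta\in(0,\pi/2).$$
   Context: For a domain $\Omega\subset\mathbb{R}^3$, let $H_0^1(\Omega)$ be the Sobolev space of $H^1(\Omega)$ functions with zero trace on $\partial\Omega$. The Dirichlet Laplacian $\mathcal{A}^{\Omega}$ is the self-adjoint operator in $L_2(\Omega)$ generated by the closed positive form $\mathfrak{a}_\Omega[u,v]=(\nabla u,\nabla v)_{L_2(\Omega)}$ with domain $H_0^1(\Omega)$. Use cylindrical coordinates $(r,\varphi,z)$ in $\mathbb{R}^3$ with $r\ge0$. Put $\psi_N=2\pi/N$. For $\theta\in(0,\pi/2)$ let $\Upsilon_N^\theta$ be the regular polyhedral angle (solid convex cone) with apex at the origin and $N$ faces, whose axis of rotational symmetry is the $z$-axis and each of whose faces makes the angle $\theta$ with this axis; explicitly, $$\Upsilon_N^\theta=\{(r,\varphi,z): z\sin\theta-r\cos\theta\cos(\varphi-j\psi_N)>0,\ 0\le j\le N-1\}.$$ The regular polyhedral layer of unit width is $\Pi_N^\theta=\{x\in\Upsilon_N^\theta:\operatorname{dist}(x,\partial\Upsilon_N^\theta)\in(0,1)\}$. The essential spectrum of $\mathcal{A}^{\Pi_N^\theta}$ is a ray $[\Lambda_\dagger^\theta,+\infty)$, where $\Lambda_\dagger^\theta<\pi^2$ is the first eigenvalue of the Dirichlet Laplacian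 in the planar V-shaped waveguide of unit width whose angle is the common inner dihedral angle of $\Upsilon_N^\theta$. It is known that the discrete spectrum of $\mathcal{A}^{\Pi_N^\theta}$ below $\Lambda_\dagger^\theta$ is nonempty and finite; $\lambda_1(\mathcal{A}^{\Pi_N^\theta})$ denotes its smallest element. *)

theory Defs
  imports "HOL-Analysis.Analysis"
begin

section \<open>Test functions and Sobolev spaces\<close>

definition pderivative :: "'n::finite \<Rightarrow> (real^'n \<Rightarrow> complex) \<Rightarrow> real^'n \<Rightarrow> complex" where
  "pderivative i f x = frechet_derivative f (at x) (axis i 1)"

primrec Ck :: "nat \<Rightarrow> (real^'n::finite \<Rightarrow> complex) \<Rightarrow> bool" where
  "Ck 0 f \<longleftrightarrow> continuous_on UNIV f"
| "Ck (Suc k) f \<longleftrightarrow> f differentiable_on UNIV \<and> (\<forall>i. Ck k (pderivative i f))"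

definition test_functions :: "(real^'n::finite) set \<Rightarrow> (real^'n \<Rightarrow> complex) set" where
  "test_functions \<Omega> =
    {\<phi>. (\<forall>k. Ck k \<phi>) \<and> compact (closure {x. \<phi> x \<noteq> 0}) \<and> closure {x. \<phi> x \<noteq> 0} \<subseteq> \<Omega>}"

text \<open>
  Elements of \<open>L\<^sub>2(\<Omega>)\<close> are represented by functions; two functions represent the same element
  iff they agree almost everywhere on \<open>\<Omega>\<close>.
\<close>

definition L2 :: "(real^'n::finite) set \<Rightarrow> (real^'n \<Rightarrow> complex) set" where
  "L2 \<Omega> = {u. u \<in> borel_measurable (lebesgue_on \<Omega>) \<and>
              integrable (lebesgue_on \<Omega>) (\<lambda>x. (cmod (u x))\<^sup>2)}"

definition L2_inner :: "(real^'n::finite) set \<Rightarrow> (real^'n \<Rightarrow> complex) \<Rightarrow> (real^'n \<Rightarrow> complex) \<Rightarrow> complex" where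
  "L2_inner \<Omega> u v = (LINT x|lebesgue_on \<Omega>. u x * cnj (v x))"

definition L2_norm :: "(real^'n::finite) set \<Rightarrow> (real^'n \<Rightarrow> complex) \<Rightarrow> real" where
  "L2_norm \<Omega> u = sqrt (LINT x|lebesgue_on \<Omega>. (cmod (u x))\<^sup>2)"

definition has_weak_gradient ::
    "(real^'n::finite) set \<Rightarrow> (real^'n \<Rightarrow> complex) \<Rightarrow> (real^'n \<Rightarrow> complex^'n) \<Rightarrow> bool" where
  "has_weak_gradient \<Omega> u G \<longleftrightarrow>
    (\<forall>i. (\<lambda>x. G x $ i) \<in> L2 \<Omega>) \<and>
    (\<forall>\<phi>\<in>test_functions \<Omega>. \<forall>i.
       (LINT x|lebesgue_on \<Omega>. u x * pderivative i \<phi> x) = - (LINT x|lebesgue_on \<Omega>. G x $ i * \<phi> x))"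

text \<open>The weak gradient is unique up to a null set; the choice below is immaterial.\<close>

definition weak_gradient :: "(real^'n::finite) set \<Rightarrow> (real^'n \<Rightarrow> complex) \<Rightarrow> real^'n \<Rightarrow> complex^'n" where
  "weak_gradient \<Omega> u = (SOME G. has_weak_gradient \<Omega> u G)"

definition H1 :: "(real^'n::finite) set \<Rightarrow> (real^'n \<Rightarrow> complex) set" where
  "H1 \<Omega> = {u \<in> L2 \<Omega>. \<exists>G. has_weak_gradient \<Omega> u G}"

definition H1_norm :: "(real^'n::finite) set \<Rightarrow> (real^'n \<Rightarrow> complex) \<Rightarrow> real" where
  "H1_norm \<Omega> u =
    sqrt ((L2_norm \<Omega> u)\<^sup>2 + (\<Sum>i\<in>UNIV. (L2_norm \<Omega> (\<lambda>x. weak_gradient \<Omega> u x $ i))\<^sup>2))"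

text \<open>Zero trace on the boundary: membership in the \<open>H\<^sup>1\<close>-closure of the test functions.\<close>

definition H1_0 :: "(real^'n::finite) set \<Rightarrow> (real^'n \<Rightarrow> complex) set" where
  "H1_0 \<Omega> = {u \<in> H1 \<Omega>. \<forall>\<epsilon>>0. \<exists>\<phi>\<in>test_functions \<Omega>. H1_norm \<Omega> (\<lambda>x. u x - \<phi> x) < \<epsilon>}"


section \<open>The Dirichlet Laplacian and its spectrum\<close>

definition dirichlet_form ::
    "(real^'n::finite) set \<Rightarrow> (real^'n \<Rightarrow> complex) \<Rightarrow> (real^'n \<Rightarrow> complex) \<Rightarrow> complex" where
  "dirichlet_form \<Omega> u v =
    (\<Sum>i\<in>UNIV. L2_inner \<Omega> (\<lambda>x. weak_gradient \<Omega> u x $ i) (\<lambda>x. weak_gradient \<Omega> v x $ i))"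

text \<open>
  The graph of the operator generated by the form: \<open>dirichlet_laplacian \<Omega> u f\<close> says that \<open>u\<close> is in
  the operator domain and is mapped to \<open>f\<close>.
\<close>

definition dirichlet_laplacian ::
    "(real^'n::finite) set \<Rightarrow> (real^'n \<Rightarrow> complex) \<Rightarrow> (real^'n \<Rightarrow> complex) \<Rightarrow> bool" where
  "dirichlet_laplacian \<Omega> u f \<longleftrightarrow>
    u \<in> H1_0 \<Omega> \<and> f \<in> L2 \<Omega> \<and> (\<forall>v\<in>H1_0 \<Omega>. dirichlet_form \<Omega> u v = L2_inner \<Omega> f v)"

text \<open>
  The second condition is injectivity of the operator minus \<open>\<zeta>\<close> together with boundedness of its
  inverse.
\<close>

definition resolvent_set :: "(real^'n::finite) set \<Rightarrow> complex set" where
  "resolvent_set \<Omega> = {\<zeta>.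
    (\<forall>g\<in>L2 \<Omega>. \<exists>u f. dirichlet_laplacian \<Omega> u f \<and> (AE x in lebesgue_on \<Omega>. f x - \<zeta> * u x = g x)) \<and>
    (\<exists>C. \<forall>u f. dirichlet_laplacian \<Omega> u f \<longrightarrow> L2_norm \<Omega> u \<le> C * L2_norm \<Omega> (\<lambda>x. f x - \<zeta> * u x))}"

definition spectrum :: "(real^'n::finite) set \<Rightarrow> complex set" where
  "spectrum \<Omega> = - resolvent_set \<Omega>"

definition eigenspace :: "(real^'n::finite) set \<Rightarrow> complex \<Rightarrow> (real^'n \<Rightarrow> complex) set" where
  "eigenspace \<Omega> \<zeta> = {u. dirichlet_laplacian \<Omega> u (\<lambda>x. \<zeta> * u x)}"

definition is_eigenvalue :: "(real^'n::finite) set \<Rightarrow> complex \<Rightarrow> bool" where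
  "is_eigenvalue \<Omega> \<zeta> \<longleftrightarrow> (\<exists>u\<in>eigenspace \<Omega> \<zeta>. \<not> (AE x in lebesgue_on \<Omega>. u x = 0))"

definition finite_multiplicity :: "(real^'n::finite) set \<Rightarrow> complex \<Rightarrow> bool" where
  "finite_multiplicity \<Omega> \<zeta> \<longleftrightarrow>
    (\<exists>B. finite B \<and> B \<subseteq> eigenspace \<Omega> \<zeta> \<and>
      (\<forall>u\<in>eigenspace \<Omega> \<zeta>. \<exists>c. AE x in lebesgue_on \<Omega>. u x = (\<Sum>b\<in>B. c b * b x)))"

text \<open>The operator is self-adjoint, so its spectrum is real.\<close>

definition discrete_spectrum :: "(real^'n::finite) set \<Rightarrow> real set" where
  "discrete_spectrum \<Omega> = {E. complex_of_real E isolated_in spectrum \<Omega> \<and>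
    is_eigenvalue \<Omega> (complex_of_real E) \<and> finite_multiplicity \<Omega> (complex_of_real E)}"

definition essential_spectrum :: "(real^'n::finite) set \<Rightarrow> real set" where
  "essential_spectrum \<Omega> = {E. complex_of_real E \<in> spectrum \<Omega>} - discrete_spectrum \<Omega>"

definition discrete_spectrum_below_ess :: "(real^'n::finite) set \<Rightarrow> real set" where
  "discrete_spectrum_below_ess \<Omega> =
    {E \<in> discrete_spectrum \<Omega>. \<forall>\<mu>\<in>essential_spectrum \<Omega>. E < \<mu>}"

definition is_first_eigenvalue :: "(real^'n::finite) set \<Rightarrow> real \<Rightarrow> bool" where
  "is_first_eigenvalue \<Omega> E \<longleftrightarrow>
    E \<in> discrete_spectrum_below_ess \<Omega> \<and> (\<forall>\<mu>\<in>discrete_spectrum_below_ess \<Omega>. E \<le> \<mu>)"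


section \<open>Regular polyhedral layers\<close>

definition cylindrical :: "real \<Rightarrow> real \<Rightarrow> real \<Rightarrow> real^3" where
  "cylindrical r \<phi> z = vector [r * cos \<phi>, r * sin \<phi>, z]"

definition polyhedral_angle :: "nat \<Rightarrow> real \<Rightarrow> (real^3) set" where
  "polyhedral_angle N \<theta> = {cylindrical r \<phi> z | r \<phi> z. r \<ge> 0 \<and>
    (\<forall>j<N. z * sin \<theta> - r * cos \<theta> * cos (\<phi> - real j * (2 * pi / real N)) > 0)}"

definition polyhedral_layer :: "nat \<Rightarrow> real \<Rightarrow> (real^3) set" where
  "polyhedral_layer N \<theta> =
    {x \<in> polyhedral_angle N \<theta>. infdist x (frontier (polyhedral_angle N \<theta>)) \<in> {0<..<1}}"

end

theory Submission
  imports Defs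
begin

text \<open>
  The limit follows from two elementary bounds, one for each \<open>\<theta>\<close> and one as \<open>\<theta>\<close> approaches \<open>pi / 2\<close>.

  Lower bound. Every vertical line meets the layer inside an interval of length \<open>1 / sin \<theta>\<close>
  (\<open>polyhedral_layer_fibre\<close>). The one-dimensional Dirichlet inequality on the vertical fibres
  (\<open>fibre_poincare_test\<close>), extended to \<open>H\<^sub>0\<^sup>1\<close> by density, bounds the form below by
  \<open>pi\<^sup>2 (sin \<theta>)\<^sup>2\<close>, and the first eigenvalue is the Rayleigh quotient of an eigenfunction.

  Upper bound. For \<open>\<theta>\<close> close to \<open>pi / 2\<close> the layer is almost horizontal near the axis and contains any
  prescribed box \<open>(-L, L) \<times> (-L, L) \<times> (\<delta>, 1 - \<delta>)\<close> (\<open>box_subset_polyhedral_layer\<close>). Domain monotonicity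
  (\<open>first_eigenvalue_le_box\<close>) gives the bound \<open>2 (pi / 2L)\<^sup>2 + (pi / (1 - 2\<delta>))\<^sup>2\<close>, which is as close to
  \<open>pi\<^sup>2\<close> as desired for large \<open>L\<close> and small \<open>\<delta>\<close>.

  The upper bound needs the variational characterisation of the first eigenvalue, which here is
  defined through the resolvent. It suffices that the infimum of the Rayleigh quotients belongs to
  the spectrum (\<open>rayleigh_bottom_in_spectrum\<close>): the first eigenvalue lies below the essential spectrum
  and is the least discrete eigenvalue there, so it is at most that infimum.

  Two devices keep the analysis short. All integral identities come from the fact that a
  directional derivative of a compactly supported function has integral zero
  (\<open>integral_directional_derivative\<close>), applied to suitable quadratic expressions. One family of explicit cutoffs, converging to the indicator of a box, yields both
  the fundamental lemma of the calculus of variations, hence uniqueness of weak gradients, and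
  the trial functions.
\<close>

section \<open>The Hilbert space of square integrable functions\<close>

lemma L2_D:
  assumes "u \<in> L2 \<Omega>"
  shows "u \<in> borel_measurable (lebesgue_on \<Omega>)"
    and "integrable (lebesgue_on \<Omega>) (\<lambda>x. (cmod (u x))\<^sup>2)"
  using assms by (auto simp: L2_def)

lemma L2_mult_integrable:
  assumes u: "u \<in> L2 \<Omega>" and v: "v \<in> L2 \<Omega>"
  shows "integrable (lebesgue_on \<Omega>) (\<lambda>x. u x * v x)"
proof (rule Bochner_Integration.integrable_bound)
  show "integrable (lebesgue_on \<Omega>) (\<lambda>x. (cmod (u x))\<^sup>2 + (cmod (v x))\<^sup>2)"
    using L2_D[OF u] L2_D[OF v] by simp
  show "(\<lambda>x. u x * v x) \<in> borel_measurable (lebesgue_on \<Omega>)"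
    using L2_D[OF u] L2_D[OF v] by measurable
  have "a * b \<le> a\<^sup>2 + b\<^sup>2" for a b :: real
    using sum_squares_bound[of a b] zero_le_power2[of a] zero_le_power2[of b] by linarith
  then show "AE x in lebesgue_on \<Omega>. norm (u x * v x) \<le> norm ((cmod (u x))\<^sup>2 + (cmod (v x))\<^sup>2)"
    by (auto simp: norm_mult)
qed

lemma L2_cnj: "v \<in> L2 \<Omega> \<Longrightarrow> (\<lambda>x. cnj (v x)) \<in> L2 \<Omega>"
  by (auto simp: L2_def intro!: borel_measurable_continuous_onI continuous_intros
      measurable_compose[of v _ borel cnj])

lemma L2_inner_integrable:
  "u \<in> L2 \<Omega> \<Longrightarrow> v \<in> L2 \<Omega> \<Longrightarrow> integrable (lebesgue_on \<Omega>) (\<lambda>x. u x * cnj (v x))"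
  by (intro L2_mult_integrable L2_cnj)

lemma L2_scale: "u \<in> L2 \<Omega> \<Longrightarrow> (\<lambda>x. c * u x) \<in> L2 \<Omega>"
  by (auto simp: L2_def norm_mult power_mult_distrib)

lemma L2_add:
  assumes u: "u \<in> L2 \<Omega>" and v: "v \<in> L2 \<Omega>"
  shows "(\<lambda>x. u x + v x) \<in> L2 \<Omega>"
proof -
  have "integrable (lebesgue_on \<Omega>) (\<lambda>x. (cmod (u x + v x))\<^sup>2)"
  proof (rule Bochner_Integration.integrable_bound)
    show "integrable (lebesgue_on \<Omega>) (\<lambda>x. 2 * (cmod (u x))\<^sup>2 + 2 * (cmod (v x))\<^sup>2)"
      using L2_D[OF u] L2_D[OF v] by simp
    show "(\<lambda>x. (cmod (u x + v x))\<^sup>2) \<in> borel_measurable (lebesgue_on \<Omega>)"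
      using L2_D[OF u] L2_D[OF v] by measurable
    have "(cmod (a + b))\<^sup>2 \<le> 2 * (cmod a)\<^sup>2 + 2 * (cmod b)\<^sup>2" for a b :: complex
    proof -
      have "(cmod (a + b))\<^sup>2 \<le> (cmod a + cmod b)\<^sup>2"
        by (intro power_mono norm_triangle_ineq) simp
      also have "\<dots> \<le> 2 * (cmod a)\<^sup>2 + 2 * (cmod b)\<^sup>2"
        using sum_squares_bound[of "cmod a" "cmod b"] by (simp add: power2_sum)
      finally show ?thesis .
    qed
    then show "AE x in lebesgue_on \<Omega>. norm ((cmod (u x + v x))\<^sup>2)
        \<le> norm (2 * (cmod (u x))\<^sup>2 + 2 * (cmod (v x))\<^sup>2)"
      by auto
  qed
  then show ?thesis using L2_D[OF u] L2_D[OF v] by (auto simp: L2_def)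
qed

lemma L2_diff: "u \<in> L2 \<Omega> \<Longrightarrow> v \<in> L2 \<Omega> \<Longrightarrow> (\<lambda>x. u x - v x) \<in> L2 \<Omega>"
  using L2_add[of u \<Omega> "\<lambda>x. (-1) * v x"] L2_scale[of v \<Omega> "-1"] by simp

lemma L2_inner_add_left:
  assumes "u \<in> L2 \<Omega>" "v \<in> L2 \<Omega>" "w \<in> L2 \<Omega>"
  shows "L2_inner \<Omega> (\<lambda>x. u x + c * v x) w = L2_inner \<Omega> u w + c * L2_inner \<Omega> v w"
proof -
  note i = L2_inner_integrable
  have "L2_inner \<Omega> (\<lambda>x. u x + c * v x) w
      = (LINT x|lebesgue_on \<Omega>. u x * cnj (w x) + c * (v x * cnj (w x)))"
    by (simp add: L2_inner_def algebra_simps)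
  also have "\<dots> = L2_inner \<Omega> u w + c * L2_inner \<Omega> v w"
    unfolding L2_inner_def using i[OF assms(1,3)] i[OF assms(2,3)] by simp
  finally show ?thesis .
qed

lemma L2_inner_commute: "L2_inner \<Omega> v u = cnj (L2_inner \<Omega> u v)"
  unfolding L2_inner_def by (subst Bochner_Integration.integral_cnj[symmetric]) (simp add: mult.commute)

lemma L2_inner_add_right:
  assumes "u \<in> L2 \<Omega>" "v \<in> L2 \<Omega>" "w \<in> L2 \<Omega>"
  shows "L2_inner \<Omega> w (\<lambda>x. u x + c * v x) = L2_inner \<Omega> w u + cnj c * L2_inner \<Omega> w v"
  by (subst (1 2 3) L2_inner_commute) (simp add: L2_inner_add_left[OF assms])

lemma L2_inner_self: "L2_inner \<Omega> u u = of_real ((L2_norm \<Omega> u)\<^sup>2)"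
proof -
  have "L2_inner \<Omega> u u = (LINT x|lebesgue_on \<Omega>. complex_of_real ((cmod (u x))\<^sup>2))"
    unfolding L2_inner_def by (simp add: complex_norm_square flip: of_real_power)
  also have "\<dots> = of_real (LINT x|lebesgue_on \<Omega>. (cmod (u x))\<^sup>2)"
    by (rule integral_complex_of_real)
  finally show ?thesis by (simp add: L2_norm_def)
qed

lemma L2_norm_nonneg: "0 \<le> L2_norm \<Omega> u"
  by (simp add: L2_norm_def)

text \<open>The discriminant argument, stated without a vector space so that it serves both the
  \<open>L\<^sub>2\<close> product and the shifted Dirichlet form.\<close>

lemma hermitian_discriminant:
  assumes "\<And>t::complex. 0 \<le> A + 2 * Re (t * z) + (cmod t)\<^sup>2 * C" and "0 \<le> C"
  shows "(cmod z)\<^sup>2 \<le> A * C"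
proof -
  \<comment> \<open>choosing \<open>t = - r cnj z\<close> makes the linear term real and as negative as possible\<close>
  have *: "0 \<le> A - 2 * r * (cmod z)\<^sup>2 + r\<^sup>2 * (cmod z)\<^sup>2 * C" for r :: real
  proof -
    have "Re (- of_real r * cnj z * z) = - r * (cmod z)\<^sup>2"
      by (simp add: cmod_power2) (simp add: algebra_simps power2_eq_square)
    moreover have "(cmod (- of_real r * cnj z))\<^sup>2 = r\<^sup>2 * (cmod z)\<^sup>2"
      by (simp add: norm_mult power_mult_distrib)
    ultimately show ?thesis using assms(1)[of "- of_real r * cnj z"] by simp
  qed
  show ?thesis
  proof (cases "C = 0")
    case True
    have "(cmod z)\<^sup>2 \<le> 0"
    proof (rule ccontr)
      assume "\<not> ?thesis"
      then show False using *[of "(A + 1) / (2 * (cmod z)\<^sup>2)"] True by simp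
    qed
    then show ?thesis using True by simp
  next
    case False
    then have "C > 0" using assms by simp
    with *[of "1 / C"] show ?thesis by (simp add: field_simps power2_eq_square)
  qed
qed

lemma L2_norm_add_square:
  assumes "u \<in> L2 \<Omega>" "v \<in> L2 \<Omega>"
  shows "(L2_norm \<Omega> (\<lambda>x. u x + c * v x))\<^sup>2
    = (L2_norm \<Omega> u)\<^sup>2 + 2 * Re (c * L2_inner \<Omega> v u) + (cmod c)\<^sup>2 * (L2_norm \<Omega> v)\<^sup>2"
proof -
  have s: "(\<lambda>x. u x + c * v x) \<in> L2 \<Omega>" using assms by (intro L2_add L2_scale)
  have "complex_of_real ((L2_norm \<Omega> (\<lambda>x. u x + c * v x))\<^sup>2)
      = L2_inner \<Omega> u u + cnj c * L2_inner \<Omega> u v + c * (L2_inner \<Omega> v u + cnj c * L2_inner \<Omega> v v)"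
    by (simp add: L2_inner_self[symmetric] L2_inner_add_left[OF assms s]
        L2_inner_add_right[OF assms assms(1)] L2_inner_add_right[OF assms assms(2)] algebra_simps
        del: of_real_power)
  also have "\<dots> = of_real ((L2_norm \<Omega> u)\<^sup>2) + (cnj (c * L2_inner \<Omega> v u) + c * L2_inner \<Omega> v u)
      + c * cnj c * of_real ((L2_norm \<Omega> v)\<^sup>2)"
    by (simp add: L2_inner_self L2_inner_commute[of \<Omega> u v] algebra_simps)
  also have "cnj (c * L2_inner \<Omega> v u) + c * L2_inner \<Omega> v u = of_real (2 * Re (c * L2_inner \<Omega> v u))"
    by (simp add: complex_eq_iff)
  also have "c * cnj c = of_real ((cmod c)\<^sup>2)" by (rule complex_norm_square[symmetric])
  finally show ?thesis by (simp only: of_real_add[symmetric] of_real_mult[symmetric] of_real_eq_iff)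
qed

lemma L2_Cauchy_Schwarz:
  assumes "u \<in> L2 \<Omega>" "v \<in> L2 \<Omega>"
  shows "cmod (L2_inner \<Omega> u v) \<le> L2_norm \<Omega> u * L2_norm \<Omega> v"
proof -
  have "(cmod (L2_inner \<Omega> u v))\<^sup>2 \<le> (L2_norm \<Omega> v)\<^sup>2 * (L2_norm \<Omega> u)\<^sup>2"
  proof (rule hermitian_discriminant)
    show "0 \<le> (L2_norm \<Omega> v)\<^sup>2 + 2 * Re (t * L2_inner \<Omega> u v) + (cmod t)\<^sup>2 * (L2_norm \<Omega> u)\<^sup>2" for t
      unfolding L2_norm_add_square[OF assms(2,1), symmetric] by (rule zero_le_power2)
  qed simp
  then have "(cmod (L2_inner \<Omega> u v))\<^sup>2 \<le> (L2_norm \<Omega> u * L2_norm \<Omega> v)\<^sup>2"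
    by (simp add: power_mult_distrib mult.commute)
  then show ?thesis by (rule power2_le_imp_le) (simp add: L2_norm_nonneg)
qed

lemma L2_triangle:
  assumes "u \<in> L2 \<Omega>" "v \<in> L2 \<Omega>"
  shows "L2_norm \<Omega> (\<lambda>x. u x + c * v x) \<le> L2_norm \<Omega> u + cmod c * L2_norm \<Omega> v"
proof (rule power2_le_imp_le)
  have "Re (c * L2_inner \<Omega> v u) \<le> cmod (c * L2_inner \<Omega> v u)" by (rule complex_Re_le_cmod)
  also have "\<dots> \<le> cmod c * (L2_norm \<Omega> v * L2_norm \<Omega> u)"
    unfolding norm_mult using assms by (intro mult_left_mono L2_Cauchy_Schwarz) auto
  finally show "(L2_norm \<Omega> (\<lambda>x. u x + c * v x))\<^sup>2 \<le> (L2_norm \<Omega> u + cmod c * L2_norm \<Omega> v)\<^sup>2"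
    unfolding L2_norm_add_square[OF assms] by (simp only: power2_sum power_mult_distrib) (simp only: algebra_simps)
qed (simp add: L2_norm_nonneg)

lemma L2_norm_cong_AE:
  assumes "AE x in lebesgue_on \<Omega>. u x = v x"
    "u \<in> borel_measurable (lebesgue_on \<Omega>)" "v \<in> borel_measurable (lebesgue_on \<Omega>)"
  shows "L2_norm \<Omega> u = L2_norm \<Omega> v"
proof -
  have "(LINT x|lebesgue_on \<Omega>. (cmod (u x))\<^sup>2) = (LINT x|lebesgue_on \<Omega>. (cmod (v x))\<^sup>2)"
    by (rule integral_cong_AE) (use assms in auto)
  then show ?thesis by (simp add: L2_norm_def)
qed

lemma L2_inner_cong_AE:
  assumes "AE x in lebesgue_on \<Omega>. u x = u' x" "AE x in lebesgue_on \<Omega>. v x = v' x"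
    and "u \<in> L2 \<Omega>" "u' \<in> L2 \<Omega>" "v \<in> L2 \<Omega>" "v' \<in> L2 \<Omega>"
  shows "L2_inner \<Omega> u v = L2_inner \<Omega> u' v'"
  unfolding L2_inner_def
proof (rule integral_cong_AE)
  show "AE x in lebesgue_on \<Omega>. u x * cnj (v x) = u' x * cnj (v' x)"
    using assms(1,2) by eventually_elim simp
qed (use assms L2_inner_integrable[THEN borel_measurable_integrable] in blast)+

lemma L2_norm_eq_0_iff:
  assumes "u \<in> L2 \<Omega>"
  shows "L2_norm \<Omega> u = 0 \<longleftrightarrow> (AE x in lebesgue_on \<Omega>. u x = 0)"
  using integral_nonneg_eq_0_iff_AE[OF L2_D(2)[OF assms]] by (simp add: L2_norm_def)

section \<open>Functions with continuous partial derivatives\<close>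

lemma pderivative_eq:
  "(f has_derivative f') (at x) \<Longrightarrow> pderivative i f x = f' (axis i 1)"
  unfolding pderivative_def by (simp add: frechet_derivative_at[symmetric])

lemma Ck_Suc_imp_Ck: "Ck (Suc k) f \<Longrightarrow> Ck k f"
  by (induction k arbitrary: f) (auto intro: differentiable_imp_continuous_on)

lemma Ck_const: "Ck k (\<lambda>x. c)"
proof (induction k arbitrary: c)
  case (Suc k)
  have "pderivative i (\<lambda>x. c) = (\<lambda>x::real^'a. 0)" for i
    by (rule ext, subst pderivative_eq[OF has_derivative_const]) simp
  then show ?case using Suc by (simp add: differentiable_on_def)
qed simp

lemma pderivative_add:
  assumes "f differentiable (at x)" "g differentiable (at x)"
  shows "pderivative i (\<lambda>x. f x + g x) x = pderivative i f x + pderivative i g x"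
  using pderivative_eq[OF has_derivative_add[OF assms[unfolded frechet_derivative_works]]]
  by (simp add: pderivative_def)

lemma pderivative_mult:
  assumes "f differentiable (at x)" "g differentiable (at x)"
  shows "pderivative i (\<lambda>x. f x * g x) x = pderivative i f x * g x + f x * pderivative i g x"
  using pderivative_eq[OF has_derivative_mult[OF assms[unfolded frechet_derivative_works]]]
  by (simp add: pderivative_def add.commute)

lemma Ck_differentiable: "Ck (Suc k) f \<Longrightarrow> f differentiable (at x)"
  by (simp add: differentiable_on_def)

lemma Ck_add: "Ck k f \<Longrightarrow> Ck k g \<Longrightarrow> Ck k (\<lambda>x. f x + g x)"
proof (induction k arbitrary: f g)
  case (Suc k)
  have "pderivative i (\<lambda>x. f x + g x) = (\<lambda>x. pderivative i f x + pderivative i g x)" for i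
    using pderivative_add Ck_differentiable[OF Suc.prems(1)] Ck_differentiable[OF Suc.prems(2)] by blast
  with Suc show ?case by (auto intro: differentiable_on_add)
qed (auto intro: continuous_intros)

text \<open>Each derivative of a product is a sum of products in which one factor has lost an order; the other
  factor is used at the lower order as well, which is why \<open>Ck\<close> has to be monotone in the order first.\<close>

lemma Ck_mult: "Ck k f \<Longrightarrow> Ck k g \<Longrightarrow> Ck k (\<lambda>x. f x * g x)"
proof (induction k arbitrary: f g)
  case (Suc k)
  have *: "pderivative i (\<lambda>x. f x * g x) = (\<lambda>x. pderivative i f x * g x + f x * pderivative i g x)" for i
    using pderivative_mult Ck_differentiable[OF Suc.prems(1)] Ck_differentiable[OF Suc.prems(2)] by blast
  have "Ck k (\<lambda>x. pderivative i f x * g x + f x * pderivative i g x)" for i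
    using Suc.prems Suc.prems[THEN Ck_Suc_imp_Ck] by (intro Ck_add Suc.IH) auto
  with Suc.prems * show ?case by (auto intro: differentiable_on_mult)
qed (auto intro: continuous_intros)

lemma Ck_prod: "(\<And>j. j \<in> J \<Longrightarrow> Ck k (f j)) \<Longrightarrow> Ck k (\<lambda>x. \<Prod>j\<in>J. f j x)"
  by (induction J rule: infinite_finite_induct) (auto intro: Ck_const Ck_mult)

text \<open>All derivatives are given at once, so that composing with a coordinate is a plain induction on the
  order in \<open>Ck\<close>.\<close>

definition smooth :: "(real \<Rightarrow> real) \<Rightarrow> bool" where
  "smooth h \<longleftrightarrow> (\<exists>d. d 0 = h \<and> (\<forall>n t. (d n has_real_derivative d (Suc n) t) (at t)))"

lemma has_derivative_coordinate:
  assumes "(h has_real_derivative h') (at (x $ i))"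
  shows "((\<lambda>x::real^'n::finite. complex_of_real (h (x $ i))) has_derivative
    (\<lambda>v. complex_of_real (h' * v $ i))) (at x)"
proof (rule has_derivative_of_real)
  have "((\<lambda>x::real^'n. x $ i) has_derivative (\<lambda>v. v $ i)) (at x)"
    by (rule bounded_linear_imp_has_derivative) (rule bounded_linear_vec_nth)
  from has_derivative_compose[OF this assms[unfolded has_field_derivative_def]]
  show "((\<lambda>x. h (x $ i)) has_derivative (\<lambda>v. h' * v $ i)) (at x)" .
qed

lemma smooth_Ck_coordinate:
  assumes "smooth h"
  shows "Ck k (\<lambda>x::real^'n::finite. complex_of_real (h (x $ i)))"
proof -
  obtain d where d: "d 0 = h" "\<And>n t. (d n has_real_derivative d (Suc n) t) (at t)"
    using assms unfolding smooth_def by auto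
  note der = has_derivative_coordinate[OF d(2)]
  have "Ck k (\<lambda>x::real^'n. complex_of_real (d n (x $ i)))" for n
  proof (induction k arbitrary: n)
    case 0
    show ?case
      unfolding Ck.simps by (rule has_derivative_continuous_on, rule has_derivative_at_withinI, rule der)
  next
    case (Suc k)
    have "pderivative j (\<lambda>x::real^'n. complex_of_real (d n (x $ i))) =
        (\<lambda>x. complex_of_real (d (Suc n) (x $ i)) * (if j = i then 1 else 0))" for j
      by (rule ext, subst pderivative_eq[OF der]) (simp add: axis_def)
    moreover have "(\<lambda>x::real^'n. complex_of_real (d n (x $ i))) differentiable_on UNIV"
      using der unfolding differentiable_on_def differentiable_def by auto
    ultimately show ?case using Suc by (auto intro!: Ck_mult Ck_const)
  qed
  from this[of 0] show ?thesis by (simp add: d)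
qed

section \<open>Integrals of directional derivatives\<close>

lemma lborel_integral_translate:
  fixes F :: "'a::euclidean_space \<Rightarrow> 'b::euclidean_space"
  assumes "F \<in> borel_measurable borel"
  shows "(LINT x|lborel. F (x + c)) = (LINT x|lborel. F x)"
proof -
  have "(LINT x|lborel. F x) = (LINT x|distr lborel borel ((+) c). F x)"
    by (simp add: lborel_distr_plus)
  also have "\<dots> = (LINT x|lborel. F (c + x))"
    using assms by (subst integral_distr) auto
  finally show ?thesis by (simp add: add.commute)
qed

lemma integrable_compact_support:
  fixes F :: "'a::euclidean_space \<Rightarrow> 'b::euclidean_space"
  assumes "compact K" "\<And>x. x \<notin> K \<Longrightarrow> F x = 0" "continuous_on UNIV F"
  shows "integrable lborel F"
proof -
  have "(\<lambda>x. indicator K x *\<^sub>R F x) = F"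
    using assms(2) by (auto simp: indicator_def)
  then show ?thesis
    using borel_integrable_compact[OF assms(1) continuous_on_subset[OF assms(3)]] by auto
qed

text \<open>Integrals of difference quotients vanish by translation invariance, and the quotients are
  dominated by a multiple of the indicator of a ball. Assuming a derivative in one direction only
  admits functions that are merely continuous in the others.\<close>

lemma integral_directional_derivative:
  fixes F D :: "'a::euclidean_space \<Rightarrow> 'b::euclidean_space"
  assumes K: "compact K" and F0: "\<And>x. x \<notin> K \<Longrightarrow> F x = 0"
    and F: "continuous_on UNIV F" and D: "continuous_on UNIV D"
    and der: "\<And>x. ((\<lambda>t. F (x + t *\<^sub>R v)) has_vector_derivative D x) (at 0)"
  shows "integrable lborel D" "(LINT x|lborel. D x) = 0"
proof -
  have shift: "((\<lambda>t. F (x + t *\<^sub>R v)) has_vector_derivative D (x + s *\<^sub>R v)) (at s)" for x s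
  proof -
    have "((\<lambda>t. F ((x + s *\<^sub>R v) + t *\<^sub>R v)) \<circ> (\<lambda>t. t - s) has_vector_derivative
        1 *\<^sub>R D (x + s *\<^sub>R v)) (at s)"
      by (rule vector_diff_chain_at) (auto intro!: derivative_eq_intros der)
    then show ?thesis by (simp add: o_def algebra_simps)
  qed
  have D0: "D x = 0" if "x \<notin> K" for x
  proof -
    define S where "S = (\<lambda>t::real. x + t *\<^sub>R v) -` (- K)"
    have "open S" unfolding S_def
      using compact_imp_closed[OF K] by (intro open_vimage) (auto intro!: continuous_intros)
    moreover have "0 \<in> S" using that by (simp add: S_def)
    ultimately have "((\<lambda>t. 0) has_vector_derivative D x) (at 0)"
      by (rule has_vector_derivative_transform_within_open[OF der]) (simp add: S_def F0)
    from vector_derivative_unique_at[OF this has_vector_derivative_const] show ?thesis .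
  qed
  show intD: "integrable lborel D" by (rule integrable_compact_support[OF K D0 D])
  obtain B where B: "B > 0" "\<And>x. norm (D x) \<le> B"
  proof -
    have "bounded (D ` K)"
      using K continuous_on_subset[OF D] by (intro compact_imp_bounded compact_continuous_image) auto
    then obtain B where "B > 0" "\<And>x. x \<in> K \<Longrightarrow> norm (D x) \<le> B" unfolding bounded_pos by auto
    show thesis
    proof (rule that)
      show "norm (D x) \<le> B" for x
        using \<open>B > 0\<close> \<open>\<And>x. x \<in> K \<Longrightarrow> norm (D x) \<le> B\<close> D0[of x] by (cases "x \<in> K") auto
    qed fact
  qed
  have lip: "norm (F (x + h *\<^sub>R v) - F x) \<le> B * h" if "h > 0" for h x
  proof -
    have "norm (F (x + h *\<^sub>R v) - F (x + 0 *\<^sub>R v)) \<le> B * norm (h - 0)"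
    proof (rule differentiable_bound[where S = UNIV])
      show "((\<lambda>t. F (x + t *\<^sub>R v)) has_derivative (\<lambda>t. t *\<^sub>R D (x + s *\<^sub>R v))) (at s within UNIV)" for s
        using shift[of x s] by (simp add: has_vector_derivative_def)
      show "onorm (\<lambda>t. t *\<^sub>R D (x + s *\<^sub>R v)) \<le> B" for s
        by (rule onorm_bound) (use B in \<open>auto simp: mult.commute[of B] intro: mult_left_mono\<close>)
    qed auto
    then show ?thesis using that by simp
  qed
  obtain R where R: "\<And>x. x \<in> K \<Longrightarrow> norm x \<le> R"
    using compact_imp_bounded[OF K] by (auto simp: bounded_iff)
  define h where "h n = 1 / (real n + 1)" for n
  have h: "0 < h n" "h n \<le> 1" for n by (auto simp: h_def)
  define Q where "Q n x = (1 / h n) *\<^sub>R (F (x + h n *\<^sub>R v) - F x)" for n x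
  have Fm: "F \<in> borel_measurable borel" using F by (rule borel_measurable_continuous_onI)
  have Fi: "integrable lborel F" by (rule integrable_compact_support[OF K F0 F])
  have Fmt: "continuous_on UNIV (\<lambda>x. F (x + c))" for c
    by (rule continuous_on_compose2[OF F]) (auto intro: continuous_intros)
  have Fit: "integrable lborel (\<lambda>x. F (x + c))" for c
  proof -
    have "compact ((\<lambda>x. x - c) ` K)" by (intro compact_continuous_image K continuous_intros)
    moreover have "F (x + c) = 0" if "x \<notin> (\<lambda>x. x - c) ` K" for x
    proof -
      have "x + c \<notin> K" using that by (auto simp: image_iff dest: bspec[of _ _ "x + c"])
      then show "F (x + c) = 0" by (rule F0)
    qed
    ultimately show ?thesis using Fmt by (rule integrable_compact_support)
  qed
  have Q0: "(LINT x|lborel. Q n x) = 0" for n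
    unfolding Q_def using Fit[of "h n *\<^sub>R v"] Fi lborel_integral_translate[OF Fm, of "h n *\<^sub>R v"] by simp
  have "(\<lambda>n. LINT x|lborel. Q n x) \<longlonglongrightarrow> (LINT x|lborel. D x)"
  proof (rule integral_dominated_convergence)
    show "D \<in> borel_measurable lborel" using intD by simp
    show "Q n \<in> borel_measurable lborel" for n
      unfolding Q_def using Fit[of "h n *\<^sub>R v"] Fi by auto
    show "integrable lborel (\<lambda>x. B * indicator (cball 0 (R + norm v)) x :: real)"
      by (intro integrable_mult_right integrable_real_indicator emeasure_compact_finite) auto
    show "AE x in lborel. (\<lambda>n. Q n x) \<longlonglongrightarrow> D x"
    proof (rule AE_I2)
      fix x
      have "((\<lambda>t. (F (x + t *\<^sub>R v) - F x) /\<^sub>R t) \<longlongrightarrow> D x) (at 0)"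
      proof (rule LIM_zero_cancel, rule tendsto_norm_zero_cancel)
        have "((\<lambda>t. norm (F (x + t *\<^sub>R v) - F x - t *\<^sub>R D x) / norm t) \<longlongrightarrow> 0) (at 0)"
          using der[of x] by (simp add: has_vector_derivative_def has_derivative_at)
        moreover have "\<forall>\<^sub>F t in at 0. norm (F (x + t *\<^sub>R v) - F x - t *\<^sub>R D x) / norm t
            = norm ((F (x + t *\<^sub>R v) - F x) /\<^sub>R t - D x)"
        proof (rule eventually_mono[OF eventually_neq_at_within[of 0]])
          fix t :: real assume "t \<noteq> 0"
          then have "(F (x + t *\<^sub>R v) - F x) /\<^sub>R t - D x = (F (x + t *\<^sub>R v) - F x - t *\<^sub>R D x) /\<^sub>R t"
            by (simp add: scaleR_diff_right)
          then show "norm (F (x + t *\<^sub>R v) - F x - t *\<^sub>R D x) / norm t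
            = norm ((F (x + t *\<^sub>R v) - F x) /\<^sub>R t - D x)"
            by (simp only: norm_scaleR) (simp add: divide_inverse mult.commute)
        qed
        ultimately show "((\<lambda>t. norm ((F (x + t *\<^sub>R v) - F x) /\<^sub>R t - D x)) \<longlongrightarrow> 0) (at 0)"
          by (rule Lim_transform_eventually)
      qed
      moreover have "filterlim h (at 0) sequentially"
        using h(1) LIMSEQ_inverse_real_of_nat unfolding filterlim_at h_def
        by (auto simp: inverse_eq_divide add_ac intro!: always_eventually less_imp_neq[symmetric])
      ultimately show "(\<lambda>n. Q n x) \<longlonglongrightarrow> D x"
        unfolding Q_def using filterlim_compose[of "\<lambda>t. (F (x + t *\<^sub>R v) - F x) /\<^sub>R t" "nhds (D x)" "at 0" h]
        by (simp add: divide_inverse)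
    qed
    show "AE x in lborel. norm (Q n x) \<le> B * indicator (cball 0 (R + norm v)) x" for n
    proof (rule AE_I2)
      fix x
      have "norm (Q n x) \<le> B"
        using lip[OF h(1), of x n] h(1)[of n] unfolding Q_def norm_scaleR by (simp add: field_simps)
      moreover have "Q n x = 0" if "x \<notin> cball 0 (R + norm v)"
      proof -
        have "R + norm v < norm x" using that by simp
        moreover have "norm x \<le> norm (x + h n *\<^sub>R v) + h n * norm v"
          using norm_triangle_ineq4[of "x + h n *\<^sub>R v" "h n *\<^sub>R v"] h(1)[of n] by simp
        moreover have "h n * norm v \<le> norm v" using h[of n] by (simp add: mult_left_le_one_le)
        moreover have "0 \<le> norm v" by simp
        ultimately have "R < norm x" "R < norm (x + h n *\<^sub>R v)" by linarith+
        then have "x \<notin> K" "x + h n *\<^sub>R v \<notin> K" using R[of x] R[of "x + h n *\<^sub>R v"] by auto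
        then show ?thesis by (simp add: Q_def F0)
      qed
      ultimately show "norm (Q n x) \<le> B * indicator (cball 0 (R + norm v)) x"
        by (auto simp: indicator_def)
    qed
  qed
  then have "(\<lambda>n. 0) \<longlonglongrightarrow> (LINT x|lborel. D x)" by (simp only: Q0)
  then show "(LINT x|lborel. D x) = 0" by (simp add: LIMSEQ_const_iff)
qed

section \<open>Bumps and cutoffs\<close>

lemma smooth_affine:
  assumes "smooth h"
  shows "smooth (\<lambda>t. h (c * t + b))"
proof -
  obtain d where d: "d 0 = h" "\<And>n t. (d n has_real_derivative d (Suc n) t) (at t)"
    using assms unfolding smooth_def by auto
  have "((\<lambda>t. c ^ n * d n (c * t + b)) has_real_derivative c ^ Suc n * d (Suc n) (c * t + b)) (at t)"
    for n t
    by (rule derivative_eq_intros DERIV_chain2[OF d(2)] refl | simp)+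
  then show ?thesis
    unfolding smooth_def using d(1) by (intro exI[of _ "\<lambda>n t. c ^ n * d n (c * t + b)"]) auto
qed

lemma smooth_sin: "smooth sin"
  unfolding smooth_def
proof (intro exI[of _ "\<lambda>n t. sin (t + real n * (pi / 2))"] conjI allI)
  show "((\<lambda>t. sin (t + real n * (pi / 2))) has_real_derivative sin (t + real (Suc n) * (pi / 2))) (at t)"
    for n t
  proof -
    have "sin (t + real (Suc n) * (pi / 2)) = cos (t + real n * (pi / 2))"
    proof -
      have "t + real (Suc n) * (pi / 2) = (t + real n * (pi / 2)) + pi / 2"
        by (simp add: algebra_simps add_divide_distrib)
      then show ?thesis by (simp only: sin_add) simp
    qed
    then show ?thesis by (auto intro!: derivative_eq_intros)
  qed
qed simp

definition bump :: "real \<Rightarrow> real" where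
  "bump t = (if t \<le> 0 then 0 else exp (- (1 / t)))"

lemma poly_exp_decay: "((\<lambda>u. poly p u * exp (- u)) \<longlongrightarrow> 0) at_top" for p :: "real poly"
proof -
  have "((\<lambda>u. \<Sum>i\<le>degree p. coeff p i * (u ^ i / exp u)) \<longlongrightarrow> (\<Sum>i\<le>degree p. coeff p i * 0)) at_top"
    by (intro tendsto_sum tendsto_mult tendsto_const tendsto_power_div_exp_0)
  moreover have "(\<lambda>u. \<Sum>i\<le>degree p. coeff p i * (u ^ i / exp u)) = (\<lambda>u. poly p u * exp (- u))"
    by (simp add: poly_altdef exp_minus sum_distrib_right divide_inverse mult.assoc)
  ultimately show ?thesis by simp
qed

text \<open>All derivatives of the bump have the form \<open>p (1 / t) * exp (- 1 / t)\<close> with a polynomial \<open>p\<close>,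
  so one derivative computation covers every order; at \<open>0\<close> it is the decay of the exponential.\<close>

lemma smooth_bump: "smooth bump"
  and bump_deriv: "(bump has_real_derivative bump t / t\<^sup>2) (at t)"
proof -
  define H where "H p t = (if t \<le> 0 then 0 else poly p (1 / t) * exp (- (1 / t)))"
    for p :: "real poly" and t :: real
  \<comment> \<open>with \<open>u = 1 / t\<close> one has \<open>(p(u) exp (- u))' = u\<^sup>2 (p(u) - p'(u)) exp (- u)\<close>\<close>
  define S where "S p = [:0, 0, 1:] * (p - pderiv p)" for p :: "real poly"
  have der: "(H p has_real_derivative H (S p) t) (at t)" for p t
  proof (cases t "0::real" rule: linorder_cases)
    case less
    have "((\<lambda>t. 0) has_real_derivative H (S p) t) (at t)"
      using less by (simp add: H_def)
    then show ?thesis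
      by (rule has_field_derivative_transform_within_open[where S = "{..<0}"])
        (use less in \<open>auto simp: H_def\<close>)
  next
    case greater
    have "((\<lambda>t. poly p (1 / t) * exp (- (1 / t))) has_real_derivative H (S p) t) (at t)"
      using greater
      by (auto intro!: derivative_eq_intros DERIV_chain2[OF poly_DERIV]
          simp: H_def S_def field_simps power2_eq_square)
    then show ?thesis
      by (rule has_field_derivative_transform_within_open[where S = "{0<..}"])
        (use greater in \<open>auto simp: H_def\<close>)
  next
    case equal
    have "((\<lambda>h. H p h / h) \<longlongrightarrow> 0) (at 0)"
      unfolding filterlim_at_split
    proof
      show "((\<lambda>h. H p h / h) \<longlongrightarrow> 0) (at_left 0)"
        by (rule tendsto_eventually)
          (auto simp: H_def eventually_at_filter)
      have "((\<lambda>h. poly (pCons 0 p) (inverse h) * exp (- inverse h)) \<longlongrightarrow> 0) (at_right 0)"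
        by (rule filterlim_compose[OF poly_exp_decay filterlim_inverse_at_top_right])
      then show "((\<lambda>h. H p h / h) \<longlongrightarrow> 0) (at_right 0)"
        by (rule Lim_transform_eventually)
          (auto simp: H_def eventually_at_filter divide_inverse)
    qed
    then show ?thesis using equal by (simp add: DERIV_def H_def)
  qed
  have H1: "H [:1:] = bump" by (auto simp: H_def bump_def)
  then show "smooth bump"
    unfolding smooth_def using der by (intro exI[of _ "\<lambda>n. H ((S ^^ n) [:1:])"]) simp
  have "H (S [:1:]) t = bump t / t\<^sup>2"
    by (auto simp: H_def S_def bump_def power2_eq_square)
  then show "(bump has_real_derivative bump t / t\<^sup>2) (at t)"
    using der[of "[:1:]" t] by (simp add: H1)
qed

lemma bump_bounds: "0 \<le> bump t" "bump t \<le> 1"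
  by (auto simp: bump_def)

lemma bump_scaled_tendsto:
  assumes "t > 0"
  shows "(\<lambda>n. bump (real n * t - 1)) \<longlonglongrightarrow> 1"
proof -
  have top: "filterlim (\<lambda>n. real n * t - 1) at_top sequentially"
    using assms by real_asymp
  have "(\<lambda>n. exp (- inverse (real n * t - 1))) \<longlonglongrightarrow> exp (- 0)"
    by (intro tendsto_exp tendsto_minus filterlim_compose[OF tendsto_inverse_0_at_top top] filterlim_ident)
  moreover have "\<forall>\<^sub>F n in sequentially. exp (- inverse (real n * t - 1)) = bump (real n * t - 1)"
    using filterlim_at_top_dense[THEN iffD1, OF top, rule_format, of 0]
    by eventually_elim (simp add: bump_def divide_inverse)
  ultimately show ?thesis by (auto intro: Lim_transform_eventually)
qed

lemma test_functions_D:
  assumes "\<phi> \<in> test_functions \<Omega>"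
  shows "Ck k \<phi>"
    and "\<exists>K. compact K \<and> K \<subseteq> \<Omega> \<and> (\<forall>x. x \<notin> K \<longrightarrow> \<phi> x = 0)"
  using assms closure_subset[of "{x. \<phi> x \<noteq> 0}"] unfolding test_functions_def
  by (blast, intro exI[of _ "closure {x. \<phi> x \<noteq> 0}"]) blast

lemma test_functions_I:
  assumes "\<And>k. Ck k \<phi>" "compact K" "K \<subseteq> \<Omega>" "\<And>x. x \<notin> K \<Longrightarrow> \<phi> x = 0"
  shows "\<phi> \<in> test_functions \<Omega>"
proof -
  have "closure {x. \<phi> x \<noteq> 0} \<subseteq> K"
    using assms by (intro closure_minimal compact_imp_closed) auto
  then show ?thesis
    using assms unfolding test_functions_def
    by (auto intro: bounded_subset[OF compact_imp_bounded])
qed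

lemma test_functions_add:
  assumes "\<phi> \<in> test_functions \<Omega>" "\<psi> \<in> test_functions \<Omega>"
  shows "(\<lambda>x. \<phi> x + c * \<psi> x) \<in> test_functions \<Omega>"
proof -
  obtain K L where "compact K" "K \<subseteq> \<Omega>" "\<forall>x. x \<notin> K \<longrightarrow> \<phi> x = 0"
    "compact L" "L \<subseteq> \<Omega>" "\<forall>x. x \<notin> L \<longrightarrow> \<psi> x = 0"
    using assms[THEN test_functions_D(2)] by auto
  then show ?thesis
    using assms[THEN test_functions_D(1)]
    by (intro test_functions_I[of _ "K \<union> L"] Ck_add Ck_mult Ck_const) auto
qed

text \<open>The factors vanish within distance \<open>1 / n\<close> of the left and of the right end point, so the support
  is a compact part of the open interval, and both tend to \<open>1\<close> inside.\<close>

definition cutoff :: "real \<Rightarrow> real \<Rightarrow> nat \<Rightarrow> real \<Rightarrow> real" where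
  "cutoff a b n t = bump (real n * (t - a) - 1) * bump (real n * (b - t) - 1)"

lemma smooth_times_Ck:
  assumes "smooth g" "smooth h"
  shows "Ck k (\<lambda>x::real^'n::finite. complex_of_real (g (x $ i) * h (x $ i)))"
  using Ck_mult[OF assms[THEN smooth_Ck_coordinate]] by simp

lemma cutoff_Ck: "Ck k (\<lambda>x::real^'n::finite. complex_of_real (cutoff a b n (x $ i)))"
proof -
  have "smooth (\<lambda>t. bump (real n * t + (- real n * a - 1)))"
    "smooth (\<lambda>t. bump (- real n * t + (real n * b - 1)))"
    by (intro smooth_affine smooth_bump)+
  from smooth_times_Ck[OF this] show ?thesis by (simp add: cutoff_def algebra_simps)
qed

lemma cutoff_bounds: "0 \<le> cutoff a b n t" "cutoff a b n t \<le> 1"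
  by (auto simp: cutoff_def bump_bounds intro!: mult_nonneg_nonneg mult_le_one)

lemma cutoff_zero: "t \<notin> {a<..<b} \<Longrightarrow> cutoff a b n t = 0"
  and cutoff_zero': "n > 0 \<Longrightarrow> t \<notin> {a + 1 / n .. b - 1 / n} \<Longrightarrow> cutoff a b n t = 0"
proof -
  show "cutoff a b n t = 0" if "t \<notin> {a<..<b}"
  proof -
    have "real n * (t - a) \<le> 0 \<or> real n * (b - t) \<le> 0"
      using that by (auto simp: mult_le_0_iff)
    then show ?thesis by (auto simp: cutoff_def bump_def)
  qed
  show "cutoff a b n t = 0" if "n > 0" "t \<notin> {a + 1 / n .. b - 1 / n}"
  proof -
    have "real n * (t - a) \<le> 1 \<or> real n * (b - t) \<le> 1"
      using that by (auto simp: field_simps)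
    then show ?thesis by (auto simp: cutoff_def bump_def)
  qed
qed

lemma cutoff_tendsto:
  "(\<lambda>n. cutoff a b n t) \<longlonglongrightarrow> (if t \<in> {a<..<b} then 1 else 0)"
proof (cases "t \<in> {a<..<b}")
  case True
  then have "(\<lambda>n. cutoff a b n t) \<longlonglongrightarrow> 1 * 1"
    unfolding cutoff_def by (intro tendsto_mult bump_scaled_tendsto) auto
  then show ?thesis using True by simp
next
  case False
  then show ?thesis by (simp only: cutoff_zero[OF False] if_False tendsto_const)
qed

definition box_cutoff :: "real^'n::finite \<Rightarrow> real^'n \<Rightarrow> nat \<Rightarrow> real^'n \<Rightarrow> real" where
  "box_cutoff a b n x = (\<Prod>i\<in>UNIV. cutoff (a $ i) (b $ i) n (x $ i))"

lemma box_cutoff_Ck: "Ck k (\<lambda>x. complex_of_real (box_cutoff a b n x))"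
  unfolding box_cutoff_def of_real_prod by (intro Ck_prod cutoff_Ck)

lemma box_cutoff_bounds: "0 \<le> box_cutoff a b n x" "box_cutoff a b n x \<le> 1"
  by (auto simp: box_cutoff_def cutoff_bounds intro!: prod_nonneg prod_le_1)

lemma box_cutoff_zero:
  assumes "x \<notin> box a b"
  shows "box_cutoff a b n x = 0"
proof -
  obtain i where "x $ i \<notin> {a $ i<..<b $ i}" using assms by (auto simp: mem_box_cart)
  then have "cutoff (a $ i) (b $ i) n (x $ i) = 0" by (rule cutoff_zero)
  then show ?thesis unfolding box_cutoff_def by (intro prod_zero) auto
qed

lemma box_cutoff_tendsto: "(\<lambda>n. box_cutoff a b n x) \<longlonglongrightarrow> indicator (box a b) x"
proof -
  have "(\<lambda>n. box_cutoff a b n x) \<longlonglongrightarrow> (\<Prod>i\<in>UNIV. if x $ i \<in> {a $ i<..<b $ i} then 1 else 0)"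
    unfolding box_cutoff_def by (intro tendsto_prod cutoff_tendsto)
  also have "(\<Prod>i\<in>UNIV. if x $ i \<in> {a $ i<..<b $ i} then 1 else 0) = (indicator (box a b) x :: real)"
  proof (cases "x \<in> box a b")
    case True
    then show ?thesis by (simp add: mem_box_cart)
  next
    case False
    then obtain i where "x $ i \<notin> {a $ i<..<b $ i}" by (auto simp: mem_box_cart)
    then show ?thesis using False by (auto intro!: prod_zero)
  qed
  finally show ?thesis .
qed

lemma box_cutoff_support:
  assumes "n > 0"
  shows "\<exists>K. compact K \<and> K \<subseteq> box a b \<and> (\<forall>x. x \<notin> K \<longrightarrow> box_cutoff a b n x = 0)"
proof (intro exI conjI allI impI)
  let ?K = "cbox (\<chi> i. a $ i + 1 / n) (\<chi> i. b $ i - 1 / n)"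
  show "compact ?K" by (rule compact_cbox)
  show "?K \<subseteq> box a b"
  proof
    fix x assume "x \<in> ?K"
    moreover have "0 < 1 / real n" using assms by simp
    ultimately have "a $ i < x $ i \<and> x $ i < b $ i" for i
      by (simp only: mem_box_cart vec_lambda_beta) (drule spec[of _ i], linarith)
    then show "x \<in> box a b" by (simp add: mem_box_cart)
  qed
  fix x assume "x \<notin> ?K"
  then obtain i where "x $ i \<notin> {a $ i + 1 / n .. b $ i - 1 / n}" by (auto simp: mem_box_cart)
  then have "cutoff (a $ i) (b $ i) n (x $ i) = 0" by (rule cutoff_zero'[OF assms])
  then show "box_cutoff a b n x = 0" unfolding box_cutoff_def by (intro prod_zero) auto
qed

section \<open>Test functions and the fundamental lemma of the calculus of variations\<close>

lemma lebesgue_on_integral_eq: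
  fixes f :: "'a::euclidean_space \<Rightarrow> 'b::euclidean_space"
  assumes "open \<Omega>"
  shows "(LINT x|lebesgue_on \<Omega>. f x) = (LINT x|lebesgue. indicator \<Omega> x *\<^sub>R f x)"
  using assms by (intro integral_restrict_space) auto

lemma compact_support_integral:
  fixes f :: "'a::euclidean_space \<Rightarrow> 'b::euclidean_space"
  assumes "open \<Omega>" "compact K" "K \<subseteq> \<Omega>" "\<And>x. x \<notin> K \<Longrightarrow> f x = 0" "continuous_on UNIV f"
  shows "(LINT x|lebesgue_on \<Omega>. f x) = (LINT x|lborel. f x)"
    and "integrable (lebesgue_on \<Omega>) f"
proof -
  have f: "(\<lambda>x. indicator \<Omega> x *\<^sub>R f x) = f"
    using assms(3,4) by (auto simp: indicator_def fun_eq_iff)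
  have m: "f \<in> borel_measurable lborel"
    using borel_measurable_continuous_onI[OF assms(5)] by simp
  show "(LINT x|lebesgue_on \<Omega>. f x) = (LINT x|lborel. f x)"
    unfolding lebesgue_on_integral_eq[OF assms(1)] f using integral_completion[OF m] .
  show "integrable (lebesgue_on \<Omega>) f"
    using assms(1) integrable_completion[OF m] integrable_compact_support[OF assms(2,4,5)]
    by (subst integrable_restrict_space) (auto simp: f)
qed

lemma compact_support_L2:
  fixes f :: "real^'n::finite \<Rightarrow> complex"
  assumes "open \<Omega>" "compact K" "K \<subseteq> \<Omega>" "\<And>x. x \<notin> K \<Longrightarrow> f x = 0" "continuous_on UNIV f"
  shows "f \<in> L2 \<Omega>"
proof -
  have "integrable (lebesgue_on \<Omega>) (\<lambda>x. (cmod (f x))\<^sup>2)"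
    by (rule compact_support_integral(2)[OF assms(1,2,3)])
      (use assms(4,5) in \<open>auto intro!: continuous_intros\<close>)
  then show ?thesis
    using compact_support_integral(2)[OF assms] by (simp add: L2_def)
qed

lemma pderivative_along_axis:
  assumes "f differentiable (at x)"
  shows "((\<lambda>t. f (x + t *\<^sub>R axis i 1)) has_vector_derivative pderivative i f x) (at 0)"
proof -
  have f: "(f has_derivative frechet_derivative f (at x)) (at (x + 0 *\<^sub>R axis i 1))"
    using assms by (simp add: frechet_derivative_works)
  have "((\<lambda>t. x + t *\<^sub>R axis i 1) has_derivative (\<lambda>t. t *\<^sub>R axis i 1)) (at (0::real))"
    by (auto intro!: derivative_eq_intros)
  from has_derivative_compose[OF this f]
  have "((\<lambda>t. f (x + t *\<^sub>R axis i 1)) has_derivative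
      (\<lambda>t. frechet_derivative f (at x) (t *\<^sub>R axis i 1))) (at 0)" .
  moreover have "frechet_derivative f (at x) (t *\<^sub>R axis i 1) = t *\<^sub>R pderivative i f x" for t
    using assms unfolding pderivative_def
    by (intro linear_cmul linear_frechet_derivative)
  ultimately show ?thesis by (simp add: has_vector_derivative_def)
qed

lemma pderivative_support:
  assumes "compact K" "\<And>x. x \<notin> K \<Longrightarrow> f x = 0" "x \<notin> K"
  shows "pderivative i f x = 0"
proof -
  have "((\<lambda>x. 0) has_derivative (\<lambda>v. 0)) (at x)" by simp
  then have "(f has_derivative (\<lambda>v. 0)) (at x)"
    by (rule has_derivative_transform_within_open[where s = "- K"])
      (use assms compact_imp_closed in auto)
  then show ?thesis by (rule pderivative_eq)
qed

lemma test_functions_differentiable: "\<phi> \<in> test_functions \<Omega> \<Longrightarrow> \<phi> differentiable (at x)"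
  by (intro Ck_differentiable[of 0] test_functions_D(1))

lemma test_functions_continuous: "\<phi> \<in> test_functions \<Omega> \<Longrightarrow> continuous_on UNIV \<phi>"
  using test_functions_D(1)[of \<phi> \<Omega> 0] by simp

lemma test_functions_continuous_pderivative:
  "\<phi> \<in> test_functions \<Omega> \<Longrightarrow> continuous_on UNIV (pderivative i \<phi>)"
  using test_functions_D(1)[of \<phi> \<Omega> "Suc 0"] by simp

lemma test_functions_L2:
  assumes "open \<Omega>" "\<phi> \<in> test_functions \<Omega>"
  shows "\<phi> \<in> L2 \<Omega>" "pderivative i \<phi> \<in> L2 \<Omega>"
proof -
  obtain K where K: "compact K" "K \<subseteq> \<Omega>" "\<And>x. x \<notin> K \<Longrightarrow> \<phi> x = 0"
    using test_functions_D(2)[OF assms(2)] by auto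
  show "\<phi> \<in> L2 \<Omega>"
    by (rule compact_support_L2[OF assms(1) K test_functions_continuous[OF assms(2)]])
  show "pderivative i \<phi> \<in> L2 \<Omega>"
    by (rule compact_support_L2[OF assms(1) K(1,2) pderivative_support[OF K(1)]
      test_functions_continuous_pderivative[OF assms(2)]]) (use K(3) in auto)
qed

text \<open>Integration by parts: the directional derivative of the compactly supported product of two test
  functions has integral zero.\<close>

lemma test_function_has_weak_gradient:
  assumes "open \<Omega>" "\<phi> \<in> test_functions \<Omega>"
  shows "has_weak_gradient \<Omega> \<phi> (\<lambda>x. \<chi> i. pderivative i \<phi> x)"
  unfolding has_weak_gradient_def
proof (intro conjI allI ballI)
  fix i show "(\<lambda>x. (\<chi> i. pderivative i \<phi> x) $ i) \<in> L2 \<Omega>"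
    using test_functions_L2(2)[OF assms] by simp
next
  fix \<psi> i assume \<psi>: "\<psi> \<in> test_functions \<Omega>"
  obtain K where K: "compact K" "K \<subseteq> \<Omega>" "\<And>x. x \<notin> K \<Longrightarrow> \<phi> x = 0"
    using test_functions_D(2)[OF assms(2)] by auto
  have p0: "pderivative i \<phi> x = 0" if "x \<notin> K" for x
    using pderivative_support[of K \<phi>] K that by blast
  note c = test_functions_continuous[OF assms(2)] test_functions_continuous[OF \<psi>]
    test_functions_continuous_pderivative[OF assms(2), of i]
    test_functions_continuous_pderivative[OF \<psi>, of i]
  let ?F = "\<lambda>x. \<phi> x * \<psi> x" and ?A = "\<lambda>x. pderivative i \<phi> x * \<psi> x" and ?B = "\<lambda>x. \<phi> x * pderivative i \<psi> x"
  have d: "pderivative i ?F = (\<lambda>x. ?A x + ?B x)"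
    using pderivative_mult test_functions_differentiable[OF assms(2)]
      test_functions_differentiable[OF \<psi>] by blast
  have "(LINT x|lborel. ?A x + ?B x) = 0"
  proof (rule integral_directional_derivative(2)[OF K(1)])
    show "((\<lambda>t. ?F (x + t *\<^sub>R axis i 1)) has_vector_derivative ?A x + ?B x) (at 0)" for x
      unfolding fun_cong[OF d, symmetric]
      by (intro pderivative_along_axis differentiable_mult test_functions_differentiable[OF assms(2)]
          test_functions_differentiable[OF \<psi>])
  qed (use K c in \<open>auto intro!: continuous_intros\<close>)
  moreover have "integrable lborel ?A" "integrable lborel ?B"
    by (rule integrable_compact_support[OF K(1)]; use p0 K(3) c in \<open>auto intro!: continuous_intros\<close>)+
  ultimately have "(LINT x|lborel. ?B x) = - (LINT x|lborel. ?A x)"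
    by (simp add: eq_neg_iff_add_eq_0 add.commute)
  moreover have "(LINT x|lebesgue_on \<Omega>. ?A x) = (LINT x|lborel. ?A x)"
    "(LINT x|lebesgue_on \<Omega>. ?B x) = (LINT x|lborel. ?B x)"
    by (rule compact_support_integral(1)[OF assms(1) K(1,2)];
        use p0 K(3) c in \<open>auto intro!: continuous_intros\<close>)+
  ultimately show "(LINT x|lebesgue_on \<Omega>. \<phi> x * pderivative i \<psi> x) =
      - (LINT x|lebesgue_on \<Omega>. (\<chi> i. pderivative i \<phi> x) $ i * \<psi> x)"
    by simp
qed

lemma box_cutoff_test:
  assumes "n > 0" "box a b \<subseteq> \<Omega>"
  shows "(\<lambda>x. complex_of_real (box_cutoff a b n x)) \<in> test_functions \<Omega>"
proof -
  obtain K where "compact K" "K \<subseteq> box a b" "\<forall>x. x \<notin> K \<longrightarrow> box_cutoff a b n x = 0"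
    using box_cutoff_support[OF assms(1)] by blast
  then show ?thesis using assms(2) by (intro test_functions_I[of _ K] box_cutoff_Ck) auto
qed

text \<open>The cutoffs turn orthogonality to all test functions into vanishing integrals over all boxes
  inside \<open>\<Omega>\<close>, and almost every value is a limit of means over cubes.\<close>

lemma fundamental_lemma:
  fixes g :: "real^'n::finite \<Rightarrow> complex"
  assumes \<Omega>: "open \<Omega>" and g: "g \<in> L2 \<Omega>"
    and ortho: "\<And>\<phi>. \<phi> \<in> test_functions \<Omega> \<Longrightarrow> (LINT x|lebesgue_on \<Omega>. g x * \<phi> x) = 0"
  shows "AE x in lebesgue_on \<Omega>. g x = 0"
proof -
  define f where "f x = indicator \<Omega> x *\<^sub>R g x" for x
  have \<Omega>s: "\<Omega> \<in> sets lebesgue" using \<Omega> by auto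
  have fm: "f \<in> borel_measurable lebesgue"
    using L2_D(1)[OF g] \<Omega>s unfolding f_def by (subst borel_measurable_restrict_space_iff[symmetric]) auto
  have f2: "integrable lebesgue (\<lambda>x. (cmod (f x))\<^sup>2)"
  proof -
    have "(\<lambda>x. (cmod (f x))\<^sup>2) = (\<lambda>x. indicator \<Omega> x *\<^sub>R (cmod (g x))\<^sup>2)"
      by (auto simp: f_def indicator_def)
    then show ?thesis using L2_D(2)[OF g] \<Omega>s by (simp add: integrable_restrict_space)
  qed
  have int: "set_integrable lebesgue (cbox a b) f" for a b
    unfolding set_integrable_def
  proof (rule Bochner_Integration.integrable_bound)
    show "integrable lebesgue (\<lambda>x. (cmod (f x))\<^sup>2 + indicator (cbox a b) x)"
      using f2 by (intro Bochner_Integration.integrable_add integrable_real_indicator) (auto simp: emeasure_lborel_cbox_eq)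
    show "(\<lambda>x. indicator (cbox a b) x *\<^sub>R f x) \<in> borel_measurable lebesgue"
      by (intro borel_measurable_scaleR borel_measurable_indicator fm) auto
    have "s \<le> s\<^sup>2 + 1" for s :: real
      using sum_squares_bound[of s 1] by simp (smt (verit) zero_le_power2)
    then show "AE x in lebesgue. norm (indicator (cbox a b) x *\<^sub>R f x)
        \<le> norm ((cmod (f x))\<^sup>2 + indicator (cbox a b) x)"
      by (auto simp: indicator_def)
  qed
  have box0: "integral (cbox a b) f = 0" if "cbox a b \<subseteq> \<Omega>" for a b
  proof -
    have "(\<lambda>n. LINT x|lebesgue. f x * box_cutoff a b (Suc n) x)
        \<longlonglongrightarrow> (LINT x|lebesgue. indicator (box a b) x *\<^sub>R f x)"
    proof (rule integral_dominated_convergence)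
      show "integrable lebesgue (\<lambda>x. norm (indicator (cbox a b) x *\<^sub>R f x))"
        using int[of a b] unfolding set_integrable_def by (rule integrable_norm)
      show "(\<lambda>x. indicator (box a b) x *\<^sub>R f x) \<in> borel_measurable lebesgue"
        by (intro borel_measurable_scaleR borel_measurable_indicator fm) auto
      show "(\<lambda>x. f x * complex_of_real (box_cutoff a b (Suc n) x)) \<in> borel_measurable lebesgue" for n
      proof -
        have "(\<lambda>x. complex_of_real (box_cutoff a b (Suc n) x)) \<in> borel_measurable borel"
          using box_cutoff_Ck[of 0] by (intro borel_measurable_continuous_onI) simp
        then have "(\<lambda>x. complex_of_real (box_cutoff a b (Suc n) x)) \<in> borel_measurable lebesgue"
          by (intro measurable_completion) simp
        then show ?thesis using fm by measurable
      qed
      show "AE x in lebesgue. (\<lambda>n. f x * complex_of_real (box_cutoff a b (Suc n) x))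
          \<longlonglongrightarrow> indicator (box a b) x *\<^sub>R f x"
      proof (rule AE_I2)
        fix x
        have "(\<lambda>n. f x * complex_of_real (box_cutoff a b (Suc n) x))
            \<longlonglongrightarrow> f x * complex_of_real (indicator (box a b) x)"
          by (intro tendsto_mult tendsto_const tendsto_of_real LIMSEQ_Suc box_cutoff_tendsto)
        then show "(\<lambda>n. f x * complex_of_real (box_cutoff a b (Suc n) x))
          \<longlonglongrightarrow> indicator (box a b) x *\<^sub>R f x" by (simp add: scaleR_conv_of_real mult.commute)
      qed
      show "AE x in lebesgue. norm (f x * complex_of_real (box_cutoff a b (Suc n) x))
          \<le> norm (indicator (cbox a b) x *\<^sub>R f x)" for n
      proof (rule AE_I2)
        fix x
        show "norm (f x * complex_of_real (box_cutoff a b (Suc n) x))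
          \<le> norm (indicator (cbox a b) x *\<^sub>R f x)"
          using box_cutoff_zero[of x a b "Suc n"] box_cutoff_bounds[of a b "Suc n" x] box_subset_cbox[of a b]
          by (cases "x \<in> box a b") (auto simp: norm_mult mult_left_le)
      qed
    qed
    moreover have "(LINT x|lebesgue. f x * box_cutoff a b (Suc n) x) = 0" for n
    proof -
      have "box a b \<subseteq> \<Omega>" using that box_subset_cbox by blast
      then have "(LINT x|lebesgue_on \<Omega>. g x * box_cutoff a b (Suc n) x) = 0"
        by (intro ortho box_cutoff_test) auto
      then show ?thesis by (simp add: lebesgue_on_integral_eq[OF \<Omega>] f_def)
    qed
    ultimately have "(LINT x|lebesgue. indicator (box a b) x *\<^sub>R f x) = 0"
      by (simp add: LIMSEQ_const_iff)
    moreover have "set_integrable lebesgue (box a b) f"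
      using int[of a b] by (rule set_integrable_subset) (auto simp: box_subset_cbox)
    ultimately have "integral (box a b) f = 0"
      using set_lebesgue_integral_eq_integral(2)[of "box a b" f] by (simp add: set_lebesgue_integral_def)
    then show ?thesis by (simp add: integral_open_interval)
  qed
  have "f integrable_on cbox a b" for a b
    using int[of a b] by (rule set_lebesgue_integral_eq_integral(1))
  then obtain N where N: "negligible N" "\<And>x e. \<lbrakk>x \<notin> N; 0 < e\<rbrakk> \<Longrightarrow> \<exists>d>0. \<forall>h. 0 < h \<and> h < d \<longrightarrow>
      norm (integral (cbox x (x + h *\<^sub>R One)) f /\<^sub>R h ^ DIM(real^'n) - f x) < e"
    using integrable_ccontinuous_explicit[of f] by blast
  have f0: "f x = 0" if xN: "x \<notin> N" and x\<Omega>: "x \<in> \<Omega>" for x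
  proof (rule ccontr)
    assume "f x \<noteq> 0"
    then obtain d where d: "d > 0" "\<And>h. 0 < h \<Longrightarrow> h < d \<Longrightarrow>
        norm (integral (cbox x (x + h *\<^sub>R One)) f /\<^sub>R h ^ DIM(real^'n) - f x) < norm (f x)"
      using N(2)[OF xN, of "norm (f x)"] by auto
    obtain e where e: "e > 0" "cball x e \<subseteq> \<Omega>"
      using \<Omega> x\<Omega> open_contains_cball by blast
    define h where "h = min (d / 2) (e / (norm (One::real^'n) + 1))"
    have pos: "norm (One::real^'n) + 1 > 0" by (simp add: add_nonneg_pos)
    have h: "0 < h" "h < d" using d(1) e(1) pos by (auto simp: h_def)
    have "cbox x (x + h *\<^sub>R One) \<subseteq> cball x e"
    proof
      fix y assume y: "y \<in> cbox x (x + h *\<^sub>R One)"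
      have "norm (y - x) \<le> norm (h *\<^sub>R One :: real^'n)"
      proof (rule norm_le_componentwise)
        fix b :: "real^'n" assume "b \<in> Basis"
        then have "x \<bullet> b \<le> y \<bullet> b" "y \<bullet> b \<le> x \<bullet> b + h"
          using y h(1) by (auto simp: mem_box inner_add_left)
        then show "\<bar>(y - x) \<bullet> b\<bar> \<le> \<bar>(h *\<^sub>R One) \<bullet> b\<bar>"
          using \<open>b \<in> Basis\<close> h(1) by (simp add: inner_diff_left)
      qed
      also have "\<dots> \<le> h * (norm (One::real^'n) + 1)" using h(1) by simp
      also have "\<dots> \<le> e"
        using pos by (simp add: h_def pos_le_divide_eq[symmetric])
      finally show "y \<in> cball x e" by (simp add: dist_norm norm_minus_commute)
    qed
    then have "integral (cbox x (x + h *\<^sub>R One)) f = 0" using e(2) by (intro box0) auto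
    then show False using d(2)[OF h] by simp
  qed
  have "AE x in lebesgue. x \<notin> N"
    using N(1) negligible_iff_null_sets AE_not_in by blast
  then have "AE x in lebesgue. x \<in> \<Omega> \<longrightarrow> g x = 0"
    by eventually_elim (use f0 in \<open>auto simp: f_def\<close>)
  then show ?thesis using \<Omega>s by (simp add: AE_restrict_space_iff)
qed

section \<open>Weak gradients and the Dirichlet form\<close>

text \<open>Uniqueness makes the chosen weak gradient additive almost everywhere and equal to the
  classical gradient on test functions; all later computations with the form rest on it.\<close>

lemma weak_gradient_unique:
  assumes \<Omega>: "open \<Omega>" and "has_weak_gradient \<Omega> u G" "has_weak_gradient \<Omega> u G'"
  shows "AE x in lebesgue_on \<Omega>. G x $ i = G' x $ i"
proof -
  have L: "(\<lambda>x. G x $ i) \<in> L2 \<Omega>" "(\<lambda>x. G' x $ i) \<in> L2 \<Omega>"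
    using assms(2,3) unfolding has_weak_gradient_def by auto
  have "AE x in lebesgue_on \<Omega>. G x $ i - G' x $ i = 0"
  proof (rule fundamental_lemma[OF \<Omega> L2_diff[OF L]])
    fix \<phi> assume \<phi>: "\<phi> \<in> test_functions \<Omega>"
    note L2_mult_integrable[OF L(1) test_functions_L2(1)[OF \<Omega> \<phi>]]
      L2_mult_integrable[OF L(2) test_functions_L2(1)[OF \<Omega> \<phi>]]
    then have "(LINT x|lebesgue_on \<Omega>. (G x $ i - G' x $ i) * \<phi> x)
        = (LINT x|lebesgue_on \<Omega>. G x $ i * \<phi> x) - (LINT x|lebesgue_on \<Omega>. G' x $ i * \<phi> x)"
      by (simp add: left_diff_distrib)
    also have "\<dots> = 0"
      using assms(2,3) \<phi> unfolding has_weak_gradient_def by (auto dest!: bspec[of _ _ \<phi>] spec[of _ i])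
    finally show "(LINT x|lebesgue_on \<Omega>. (G x $ i - G' x $ i) * \<phi> x) = 0" .
  qed
  then show ?thesis by eventually_elim simp
qed

abbreviation weak_partial :: "(real^'n::finite) set \<Rightarrow> 'n \<Rightarrow> (real^'n \<Rightarrow> complex) \<Rightarrow> real^'n \<Rightarrow> complex" where
  "weak_partial \<Omega> i u \<equiv> (\<lambda>x. weak_gradient \<Omega> u x $ i)"

lemma H1_D:
  assumes "u \<in> H1 \<Omega>"
  shows "u \<in> L2 \<Omega>" "has_weak_gradient \<Omega> u (weak_gradient \<Omega> u)" "weak_partial \<Omega> i u \<in> L2 \<Omega>"
proof -
  show "u \<in> L2 \<Omega>" using assms by (simp add: H1_def)
  show "has_weak_gradient \<Omega> u (weak_gradient \<Omega> u)"
    using assms someI_ex[of "has_weak_gradient \<Omega> u"] unfolding H1_def weak_gradient_def by auto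
  then show "weak_partial \<Omega> i u \<in> L2 \<Omega>" by (simp add: has_weak_gradient_def)
qed

lemma has_weak_gradient_add:
  assumes \<Omega>: "open \<Omega>" and u: "u \<in> L2 \<Omega>" "has_weak_gradient \<Omega> u G"
    and v: "v \<in> L2 \<Omega>" "has_weak_gradient \<Omega> v G'"
  shows "has_weak_gradient \<Omega> (\<lambda>x. u x + c * v x) (\<lambda>x. \<chi> i. G x $ i + c * G' x $ i)"
  unfolding has_weak_gradient_def
proof (intro conjI allI ballI)
  fix i
  have L: "(\<lambda>x. G x $ i) \<in> L2 \<Omega>" "(\<lambda>x. G' x $ i) \<in> L2 \<Omega>"
    using u v unfolding has_weak_gradient_def by auto
  then show "(\<lambda>x. (\<chi> i. G x $ i + c * G' x $ i) $ i) \<in> L2 \<Omega>"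
    by (simp add: L2_add L2_scale)
  fix \<phi> assume \<phi>: "\<phi> \<in> test_functions \<Omega>"
  note t = test_functions_L2[OF \<Omega> \<phi>]
  have eq: "(LINT x|lebesgue_on \<Omega>. (f x + c * g x) * h x)
      = (LINT x|lebesgue_on \<Omega>. f x * h x) + c * (LINT x|lebesgue_on \<Omega>. g x * h x)"
    if "f \<in> L2 \<Omega>" "g \<in> L2 \<Omega>" "h \<in> L2 \<Omega>" for f g h
    using L2_mult_integrable[OF that(1,3)] L2_mult_integrable[OF that(2,3)]
    by (simp add: distrib_right mult.assoc)
  show "(LINT x|lebesgue_on \<Omega>. (u x + c * v x) * pderivative i \<phi> x) =
      - (LINT x|lebesgue_on \<Omega>. (\<chi> i. G x $ i + c * G' x $ i) $ i * \<phi> x)"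
    using eq[OF u(1) v(1) t(2)] eq[OF L t(1)] u(2) v(2) \<phi> unfolding has_weak_gradient_def by simp
qed

lemma H1_add:
  assumes \<Omega>: "open \<Omega>" and u: "u \<in> H1 \<Omega>" and v: "v \<in> H1 \<Omega>"
  shows "(\<lambda>x. u x + c * v x) \<in> H1 \<Omega>"
    and "AE x in lebesgue_on \<Omega>. weak_partial \<Omega> i (\<lambda>x. u x + c * v x) x
      = weak_partial \<Omega> i u x + c * weak_partial \<Omega> i v x"
proof -
  note g = has_weak_gradient_add[OF \<Omega> H1_D(1,2)[OF u] H1_D(1,2)[OF v], of c]
  show *: "(\<lambda>x. u x + c * v x) \<in> H1 \<Omega>"
    using g H1_D(1)[OF u] H1_D(1)[OF v] by (auto simp: H1_def intro: L2_add L2_scale)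
  show "AE x in lebesgue_on \<Omega>. weak_partial \<Omega> i (\<lambda>x. u x + c * v x) x
      = weak_partial \<Omega> i u x + c * weak_partial \<Omega> i v x"
    using weak_gradient_unique[OF \<Omega> H1_D(2)[OF *] g, of i] by simp
qed

lemma test_functions_H1:
  assumes "open \<Omega>" "\<phi> \<in> test_functions \<Omega>"
  shows "\<phi> \<in> H1 \<Omega>" "AE x in lebesgue_on \<Omega>. weak_partial \<Omega> i \<phi> x = pderivative i \<phi> x"
proof -
  show *: "\<phi> \<in> H1 \<Omega>"
    using test_functions_L2(1)[OF assms] test_function_has_weak_gradient[OF assms]
    by (auto simp: H1_def)
  show "AE x in lebesgue_on \<Omega>. weak_partial \<Omega> i \<phi> x = pderivative i \<phi> x"
    using weak_gradient_unique[OF assms(1) H1_D(2)[OF *] test_function_has_weak_gradient[OF assms], of i]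
    by simp
qed

lemma weak_partial_norm_add:
  assumes "open \<Omega>" "u \<in> H1 \<Omega>" "v \<in> H1 \<Omega>"
  shows "L2_norm \<Omega> (weak_partial \<Omega> i (\<lambda>x. u x + c * v x))
    \<le> L2_norm \<Omega> (weak_partial \<Omega> i u) + cmod c * L2_norm \<Omega> (weak_partial \<Omega> i v)"
proof -
  have "L2_norm \<Omega> (weak_partial \<Omega> i (\<lambda>x. u x + c * v x))
      = L2_norm \<Omega> (\<lambda>x. weak_partial \<Omega> i u x + c * weak_partial \<Omega> i v x)"
    by (intro L2_norm_cong_AE[OF H1_add(2)[OF assms]] L2_D(1) L2_add L2_scale H1_D(3) H1_add(1) assms)
  then show ?thesis using L2_triangle[OF H1_D(3)[OF assms(2)] H1_D(3)[OF assms(3)]] by simp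
qed

text \<open>The \<open>H\<^sup>1\<close> norm is equivalent to the sum of the \<open>L\<^sub>2\<close> norms, for which the triangle inequality is
  immediate; a triangle inequality up to a constant suffices for the density arguments below.\<close>

lemma H1_norm_bounds:
  shows "L2_norm \<Omega> u \<le> H1_norm \<Omega> u"
    and "L2_norm \<Omega> (weak_partial \<Omega> i u) \<le> H1_norm \<Omega> u"
    and "H1_norm \<Omega> u \<le> L2_norm \<Omega> u + (\<Sum>i\<in>UNIV. L2_norm \<Omega> (weak_partial \<Omega> i u))"
proof -
  let ?p = "\<lambda>i. L2_norm \<Omega> (weak_partial \<Omega> i u)"
  have n: "0 \<le> ?p i" "0 \<le> L2_norm \<Omega> u" for i by (rule L2_norm_nonneg)+
  have "(?p i)\<^sup>2 \<le> (\<Sum>i\<in>UNIV. (?p i)\<^sup>2)" by (rule member_le_sum) auto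
  then show "?p i \<le> H1_norm \<Omega> u" "L2_norm \<Omega> u \<le> H1_norm \<Omega> u"
    unfolding H1_norm_def by (auto intro!: real_le_rsqrt sum_nonneg simp: add_increasing)
  have "H1_norm \<Omega> u \<le> sqrt ((L2_norm \<Omega> u)\<^sup>2) + sqrt (\<Sum>i\<in>UNIV. (?p i)\<^sup>2)"
    unfolding H1_norm_def by (intro sqrt_add_le_add_sqrt sum_nonneg) auto
  also have "sqrt (\<Sum>i\<in>UNIV. (?p i)\<^sup>2) \<le> (\<Sum>i\<in>UNIV. ?p i)"
    unfolding L2_set_def[symmetric] by (rule L2_set_le_sum) (rule n(1))
  finally show "H1_norm \<Omega> u \<le> L2_norm \<Omega> u + (\<Sum>i\<in>UNIV. ?p i)" using n(2) by simp
qed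

lemma H1_norm_add:
  fixes u v :: "real^'n::finite \<Rightarrow> complex"
  assumes \<Omega>: "open \<Omega>" and u: "u \<in> H1 \<Omega>" and v: "v \<in> H1 \<Omega>"
  shows "H1_norm \<Omega> (\<lambda>x. u x + c * v x) \<le> (1 + CARD('n)) * (H1_norm \<Omega> u + cmod c * H1_norm \<Omega> v)"
proof -
  let ?b = "H1_norm \<Omega> u + cmod c * H1_norm \<Omega> v"
  have mono: "s + cmod c * t \<le> ?b" if "s \<le> H1_norm \<Omega> u" "t \<le> H1_norm \<Omega> v" for s t
    using that by (intro add_mono mult_left_mono) auto
  have p: "L2_norm \<Omega> (weak_partial \<Omega> i (\<lambda>x. u x + c * v x)) \<le> ?b" for i
    using weak_partial_norm_add[OF assms] mono[OF H1_norm_bounds(2) H1_norm_bounds(2)] order.trans by blast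
  have "L2_norm \<Omega> (\<lambda>x. u x + c * v x) \<le> ?b"
    using L2_triangle[OF H1_D(1)[OF u] H1_D(1)[OF v]] mono[OF H1_norm_bounds(1) H1_norm_bounds(1)]
      order.trans by blast
  moreover have "(\<Sum>i\<in>UNIV. L2_norm \<Omega> (weak_partial \<Omega> i (\<lambda>x. u x + c * v x))) \<le> CARD('n) * ?b"
    by (rule sum_bounded_above) (rule p)
  ultimately show ?thesis
    using H1_norm_bounds(3)[of \<Omega> "\<lambda>x. u x + c * v x"] by (simp add: algebra_simps)
qed

lemma H1_0_H1: "u \<in> H1_0 \<Omega> \<Longrightarrow> u \<in> H1 \<Omega>"
  by (simp add: H1_0_def)

lemma test_functions_H1_0:
  fixes \<phi> :: "real^'n::finite \<Rightarrow> complex"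
  assumes \<Omega>: "open \<Omega>" and \<phi>: "\<phi> \<in> test_functions \<Omega>"
  shows "\<phi> \<in> H1_0 \<Omega>"
proof -
  have z: "(\<lambda>x. 0) \<in> test_functions \<Omega>"
    by (rule test_functions_I[of _ "{}"]) (auto intro: Ck_const)
  have p: "pderivative i (\<lambda>x. 0) = (\<lambda>x::real^'n. 0)" for i
    by (rule ext, rule pderivative_support[of "{}"]) auto
  have "L2_norm \<Omega> (weak_partial \<Omega> i (\<lambda>x. 0)) = L2_norm \<Omega> (\<lambda>x. 0)" for i
    using test_functions_H1(2)[OF \<Omega> z, of i] unfolding p
    by (intro L2_norm_cong_AE L2_D(1)[of "\<lambda>x. 0"] L2_D(1)[OF H1_D(3)]
        test_functions_H1(1)[OF \<Omega> z] test_functions_L2(1)[OF \<Omega> z]) auto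
  then have "H1_norm \<Omega> (\<lambda>x. 0) \<le> 0"
    using H1_norm_bounds(3)[of \<Omega> "\<lambda>x. 0"] by (simp add: L2_norm_def)
  then have "\<exists>\<psi>\<in>test_functions \<Omega>. H1_norm \<Omega> (\<lambda>x. \<phi> x - \<psi> x) < \<epsilon>" if "\<epsilon> > 0" for \<epsilon>
    using that \<phi> by (intro bexI[of _ \<phi>]) auto
  then show ?thesis using test_functions_H1(1)[OF assms] by (simp add: H1_0_def)
qed

lemma H1_0_add:
  fixes u v :: "real^'n::finite \<Rightarrow> complex"
  assumes \<Omega>: "open \<Omega>" and u: "u \<in> H1_0 \<Omega>" and v: "v \<in> H1_0 \<Omega>"
  shows "(\<lambda>x. u x + c * v x) \<in> H1_0 \<Omega>"
  unfolding H1_0_def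
proof (intro CollectI conjI allI impI)
  show "(\<lambda>x. u x + c * v x) \<in> H1 \<Omega>" using assms by (intro H1_add(1) H1_0_H1)
  fix \<epsilon> :: real assume "\<epsilon> > 0"
  define M where "M = (1 + real CARD('n)) * (1 + cmod c)"
  have "M > 0" by (auto simp: M_def intro!: mult_pos_pos add_pos_nonneg)
  then have \<delta>: "\<epsilon> / M > 0" using \<open>\<epsilon> > 0\<close> by simp
  obtain \<phi> \<psi> where \<phi>: "\<phi> \<in> test_functions \<Omega>" "H1_norm \<Omega> (\<lambda>x. u x - \<phi> x) < \<epsilon> / M"
    and \<psi>: "\<psi> \<in> test_functions \<Omega>" "H1_norm \<Omega> (\<lambda>x. v x - \<psi> x) < \<epsilon> / M"
    using u v \<delta> unfolding H1_0_def by blast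
  have d: "(\<lambda>x. u x - \<phi> x) \<in> H1 \<Omega>" "(\<lambda>x. v x - \<psi> x) \<in> H1 \<Omega>"
    using H1_add(1)[OF \<Omega> H1_0_H1[OF u] test_functions_H1(1)[OF \<Omega> \<phi>(1)], of "-1"]
      H1_add(1)[OF \<Omega> H1_0_H1[OF v] test_functions_H1(1)[OF \<Omega> \<psi>(1)], of "-1"] by simp_all
  have "H1_norm \<Omega> (\<lambda>x. (u x + c * v x) - (\<phi> x + c * \<psi> x))
      = H1_norm \<Omega> (\<lambda>x. (u x - \<phi> x) + c * (v x - \<psi> x))"
    by (simp add: algebra_simps)
  also have "\<dots> \<le> (1 + CARD('n)) * (H1_norm \<Omega> (\<lambda>x. u x - \<phi> x) + cmod c * H1_norm \<Omega> (\<lambda>x. v x - \<psi> x))"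
    by (rule H1_norm_add[OF \<Omega> d])
  also have "\<dots> < (1 + CARD('n)) * (\<epsilon> / M + cmod c * (\<epsilon> / M))"
    using \<phi>(2) \<psi>(2) by (intro mult_strict_left_mono add_less_le_mono mult_left_mono) auto
  also have "\<dots> = M * (\<epsilon> / M)" 
  proof -
    have "(1 + k) * (e + c * e) = (1 + k) * (1 + c) * e" for k c e :: real by algebra
    then show ?thesis by (simp only: M_def of_nat_add of_nat_1)
  qed
  also have "\<dots> = \<epsilon>" using \<open>M > 0\<close> by simp
  finally show "\<exists>\<eta>\<in>test_functions \<Omega>. H1_norm \<Omega> (\<lambda>x. (u x + c * v x) - \<eta> x) < \<epsilon>"
    by (rule bexI[OF _ test_functions_add[OF \<phi>(1) \<psi>(1)]])
qed

lemma dirichlet_form_add_left: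
  assumes \<Omega>: "open \<Omega>" and u: "u \<in> H1 \<Omega>" and v: "v \<in> H1 \<Omega>" and w: "w \<in> H1 \<Omega>"
  shows "dirichlet_form \<Omega> (\<lambda>x. u x + c * v x) w = dirichlet_form \<Omega> u w + c * dirichlet_form \<Omega> v w"
proof -
  have "L2_inner \<Omega> (weak_partial \<Omega> i (\<lambda>x. u x + c * v x)) (weak_partial \<Omega> i w)
      = L2_inner \<Omega> (weak_partial \<Omega> i u) (weak_partial \<Omega> i w)
        + c * L2_inner \<Omega> (weak_partial \<Omega> i v) (weak_partial \<Omega> i w)" for i
    unfolding L2_inner_add_left[OF H1_D(3)[OF u] H1_D(3)[OF v] H1_D(3)[OF w], symmetric]
    by (intro L2_inner_cong_AE[OF H1_add(2)[OF \<Omega> u v]] AE_I2 refl L2_add L2_scale H1_D(3) H1_add(1) assms)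
  then show ?thesis by (simp add: dirichlet_form_def sum.distrib sum_distrib_left)
qed

lemma dirichlet_form_commute: "dirichlet_form \<Omega> v u = cnj (dirichlet_form \<Omega> u v)"
  unfolding dirichlet_form_def cnj_sum by (intro sum.cong refl L2_inner_commute)

lemma dirichlet_form_self:
  "dirichlet_form \<Omega> u u = of_real (\<Sum>i\<in>UNIV. (L2_norm \<Omega> (weak_partial \<Omega> i u))\<^sup>2)"
  by (simp add: dirichlet_form_def L2_inner_self)

definition energy :: "(real^'n::finite) set \<Rightarrow> (real^'n \<Rightarrow> complex) \<Rightarrow> real" where
  "energy \<Omega> u = (\<Sum>i\<in>UNIV. (L2_norm \<Omega> (weak_partial \<Omega> i u))\<^sup>2)"

lemma energy_nonneg: "0 \<le> energy \<Omega> u"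
  by (simp add: energy_def sum_nonneg)

lemma energy_add:
  assumes \<Omega>: "open \<Omega>" and u: "u \<in> H1 \<Omega>" and v: "v \<in> H1 \<Omega>"
  shows "energy \<Omega> (\<lambda>x. u x + c * v x)
    = energy \<Omega> u + 2 * Re (c * dirichlet_form \<Omega> v u) + (cmod c)\<^sup>2 * energy \<Omega> v"
proof -
  let ?a = "dirichlet_form \<Omega>" and ?s = "\<lambda>x. u x + c * v x"
  have s: "?s \<in> H1 \<Omega>" using assms by (rule H1_add(1))
  have "?a w ?s = ?a w u + cnj c * ?a w v" if "w \<in> H1 \<Omega>" for w
    by (subst (1 2 3) dirichlet_form_commute) (simp add: dirichlet_form_add_left[OF \<Omega> u v that])
  from this[OF u] this[OF v]
  have "?a ?s ?s = ?a u u + (cnj c * ?a u v + c * ?a v u) + c * cnj c * ?a v v"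
    by (simp add: dirichlet_form_add_left[OF \<Omega> u v s] algebra_simps)
  also have "cnj c * ?a u v = cnj (c * ?a v u)"
    by (simp add: dirichlet_form_commute[of \<Omega> u v])
  also have "cnj (c * ?a v u) + c * ?a v u = of_real (2 * Re (c * ?a v u))"
    by (simp add: complex_eq_iff)
  also have "c * cnj c = of_real ((cmod c)\<^sup>2)" by (rule complex_norm_square[symmetric])
  finally show ?thesis
    unfolding dirichlet_form_self energy_def[symmetric]
    by (simp only: of_real_add[symmetric] of_real_mult[symmetric] of_real_eq_iff)
qed


section \<open>The bottom of the spectrum\<close>

definition rayleigh_bottom :: "(real^'n::finite) set \<Rightarrow> real" where
  "rayleigh_bottom \<Omega> = Inf {energy \<Omega> u / (L2_norm \<Omega> u)\<^sup>2 | u. u \<in> H1_0 \<Omega> \<and> L2_norm \<Omega> u \<noteq> 0}"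

lemma rayleigh_bottom_le:
  assumes "u \<in> H1_0 \<Omega>"
  shows "rayleigh_bottom \<Omega> * (L2_norm \<Omega> u)\<^sup>2 \<le> energy \<Omega> u"
proof (cases "L2_norm \<Omega> u = 0")
  case False
  have "rayleigh_bottom \<Omega> \<le> energy \<Omega> u / (L2_norm \<Omega> u)\<^sup>2"
    unfolding rayleigh_bottom_def
  proof (rule cInf_lower)
    show "bdd_below {energy \<Omega> u / (L2_norm \<Omega> u)\<^sup>2 |u. u \<in> H1_0 \<Omega> \<and> L2_norm \<Omega> u \<noteq> 0}"
      by (rule bdd_belowI[of _ 0]) (auto simp: energy_nonneg)
  qed (use assms False in auto)
  then show ?thesis using False L2_norm_nonneg[of \<Omega> u] by (simp add: pos_le_divide_eq)
qed (simp add: energy_nonneg)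

text \<open>If \<open>A - m\<close> were boundedly invertible at the infimum \<open>m\<close> of the Rayleigh quotients, take an almost
  minimiser \<open>u\<close> and solve \<open>(A - m) w = u\<close>. The form \<open>b\<close> of \<open>A - m\<close> is nonnegative, so the
  Cauchy-Schwarz inequality gives \<open>\<parallel>u\<parallel>\<^sup>4 = \<bar>b(w, u)\<bar>\<^sup>2 \<le> b(w, w) b(u, u)\<close>, where \<open>b(w, w) = (u, w)\<close> is at
  most a constant times \<open>\<parallel>u\<parallel>\<^sup>2\<close> and \<open>b(u, u)\<close> is an arbitrarily small multiple of \<open>\<parallel>u\<parallel>\<^sup>2\<close>.\<close>

lemma rayleigh_bottom_in_spectrum:
  fixes \<Omega> :: "(real^'n::finite) set"
  assumes \<Omega>: "open \<Omega>" and u0: "u0 \<in> H1_0 \<Omega>" "L2_norm \<Omega> u0 \<noteq> 0"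
  shows "complex_of_real (rayleigh_bottom \<Omega>) \<in> spectrum \<Omega>"
proof (rule ccontr)
  define m where "m = rayleigh_bottom \<Omega>"
  assume "\<not> ?thesis"
  then have "complex_of_real m \<in> resolvent_set \<Omega>" by (simp add: spectrum_def m_def)
  then obtain C where
    solve: "\<And>g :: real^'n \<Rightarrow> complex. g \<in> L2 \<Omega> \<Longrightarrow> \<exists>(u :: real^'n \<Rightarrow> complex) f. dirichlet_laplacian \<Omega> u f \<and> (AE x in lebesgue_on \<Omega>. f x - m * u x = g x)"
    and C: "\<And>(u :: real^'n \<Rightarrow> complex) f. dirichlet_laplacian \<Omega> u f \<Longrightarrow> L2_norm \<Omega> u \<le> C * L2_norm \<Omega> (\<lambda>x. f x - m * u x)"
    unfolding resolvent_set_def mem_Collect_eq by blast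
  define D where "D = max C 1"
  have "D > 0" "C \<le> D" by (auto simp: D_def)
  \<comment> \<open>an almost minimiser, close enough to the infimum to contradict the bound on the inverse\<close>
  obtain u where u: "u \<in> H1_0 \<Omega>" "L2_norm \<Omega> u \<noteq> 0" "energy \<Omega> u / (L2_norm \<Omega> u)\<^sup>2 < m + 1 / D"
  proof -
    have "Inf {energy \<Omega> u / (L2_norm \<Omega> u)\<^sup>2 | u. u \<in> H1_0 \<Omega> \<and> L2_norm \<Omega> u \<noteq> 0} < m + 1 / D"
      using \<open>D > 0\<close> by (simp add: m_def rayleigh_bottom_def)
    from cInf_lessD[OF _ this] u0 that show thesis by blast
  qed
  have n: "L2_norm \<Omega> u > 0" using u(2) L2_norm_nonneg[of \<Omega> u] by simp
  have uH: "u \<in> H1 \<Omega>" and uL: "u \<in> L2 \<Omega>" using H1_D(1) H1_0_H1[OF u(1)] by auto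
  obtain w f :: "real^'n \<Rightarrow> complex" where w: "dirichlet_laplacian \<Omega> w f" and wf: "AE x in lebesgue_on \<Omega>. f x - m * w x = u x"
    using solve[OF uL] by auto
  have w0: "w \<in> H1_0 \<Omega>" and fL: "f \<in> L2 \<Omega>"
    and eq: "\<And>v. v \<in> H1_0 \<Omega> \<Longrightarrow> dirichlet_form \<Omega> w v = L2_inner \<Omega> f v"
    using w by (auto simp: dirichlet_laplacian_def)
  have wH: "w \<in> H1 \<Omega>" and wL: "w \<in> L2 \<Omega>" using H1_D(1) H1_0_H1[OF w0] by auto
  have gL: "(\<lambda>x. f x - m * w x) \<in> L2 \<Omega>" using fL wL by (intro L2_diff L2_scale)
  have "L2_norm \<Omega> (\<lambda>x. f x - m * w x) = L2_norm \<Omega> u"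
    using wf L2_D(1)[OF gL] L2_D(1)[OF uL] by (rule L2_norm_cong_AE)
  then have wn: "L2_norm \<Omega> w \<le> D * L2_norm \<Omega> u"
    using C[OF w] \<open>C \<le> D\<close> n by (smt (verit) mult_right_mono)
  have b: "dirichlet_form \<Omega> w v - m * L2_inner \<Omega> w v = L2_inner \<Omega> u v" if v: "v \<in> H1_0 \<Omega>" for v
  proof -
    have vL: "v \<in> L2 \<Omega>" using H1_D(1) H1_0_H1[OF v] by auto
    have "L2_inner \<Omega> u v = L2_inner \<Omega> (\<lambda>x. f x + (- m) * w x) v"
      using wf gL uL vL by (intro L2_inner_cong_AE) auto
    then show ?thesis using eq[OF v] L2_inner_add_left[OF fL wL vL, of "- m"] by simp
  qed
  define A where "A = energy \<Omega> u - m * (L2_norm \<Omega> u)\<^sup>2"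
  define B where "B = energy \<Omega> w - m * (L2_norm \<Omega> w)\<^sup>2"
  have "(cmod (L2_inner \<Omega> u u))\<^sup>2 \<le> A * B"
  proof (rule hermitian_discriminant)
    show "0 \<le> A + 2 * Re (t * L2_inner \<Omega> u u) + (cmod t)\<^sup>2 * B" for t
    proof -
      have "m * (L2_norm \<Omega> (\<lambda>x. u x + t * w x))\<^sup>2 \<le> energy \<Omega> (\<lambda>x. u x + t * w x)"
        unfolding m_def by (intro rayleigh_bottom_le H1_0_add \<Omega> u w0)
      moreover have "t * L2_inner \<Omega> u u = t * dirichlet_form \<Omega> w u - m * (t * L2_inner \<Omega> w u)"
        unfolding b[OF u(1), symmetric] by (simp add: algebra_simps)
      ultimately show ?thesis
        unfolding energy_add[OF \<Omega> uH wH] L2_norm_add_square[OF uL wL] A_def B_def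
        by (simp only: minus_complex.sel Re_complex_of_real times_complex.sel Im_complex_of_real)
          (simp add: algebra_simps)
    qed
    show "0 \<le> B" using rayleigh_bottom_le[OF w0] by (simp add: B_def m_def)
  qed
  moreover have "A < (1 / D) * (L2_norm \<Omega> u)\<^sup>2"
    using u(3) n by (simp add: A_def divide_less_eq algebra_simps)
  moreover have "B \<le> D * (L2_norm \<Omega> u)\<^sup>2" and "0 \<le> A"
  proof -
    have "complex_of_real B = L2_inner \<Omega> u w"
      using b[OF w0] by (simp add: B_def dirichlet_form_self L2_inner_self energy_def)
    then have "B \<le> cmod (L2_inner \<Omega> u w)" by (metis norm_of_real abs_ge_self)
    also have "\<dots> \<le> L2_norm \<Omega> u * L2_norm \<Omega> w" by (rule L2_Cauchy_Schwarz[OF uL wL])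
    also have "\<dots> \<le> L2_norm \<Omega> u * (D * L2_norm \<Omega> u)" using wn n by (intro mult_left_mono) auto
    finally show "B \<le> D * (L2_norm \<Omega> u)\<^sup>2" by (simp add: power2_eq_square mult_ac)
    show "0 \<le> A" using rayleigh_bottom_le[OF u(1)] by (simp add: A_def m_def)
  qed
  ultimately have "((L2_norm \<Omega> u)\<^sup>2)\<^sup>2 \<le> A * (D * (L2_norm \<Omega> u)\<^sup>2)"
    by (auto simp: L2_inner_self norm_power intro: order.trans mult_left_mono)
  also have "\<dots> < (1 / D) * (L2_norm \<Omega> u)\<^sup>2 * (D * (L2_norm \<Omega> u)\<^sup>2)"
    using \<open>A < (1 / D) * (L2_norm \<Omega> u)\<^sup>2\<close> \<open>D > 0\<close> n by (intro mult_strict_right_mono) auto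
  also have "\<dots> = ((L2_norm \<Omega> u)\<^sup>2)\<^sup>2" using \<open>D > 0\<close> by (simp add: power2_eq_square)
  finally show False by simp
qed

text \<open>The bottom of the spectrum lies in the essential spectrum, or above one of its points, or in the
  discrete spectrum below it; in each case the first eigenvalue does not exceed it.\<close>

lemma first_eigenvalue_le_rayleigh_quotient:
  assumes \<Omega>: "open \<Omega>" and E: "is_first_eigenvalue \<Omega> E" and u: "u \<in> H1_0 \<Omega>" "L2_norm \<Omega> u \<noteq> 0"
  shows "E * (L2_norm \<Omega> u)\<^sup>2 \<le> energy \<Omega> u"
proof -
  let ?m = "rayleigh_bottom \<Omega>"
  have "E \<le> ?m"
  proof (cases "\<exists>\<mu>\<in>essential_spectrum \<Omega>. \<mu> \<le> ?m")
    case True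
    then show ?thesis using E by (force simp: is_first_eigenvalue_def discrete_spectrum_below_ess_def)
  next
    case False
    then have "?m \<notin> essential_spectrum \<Omega>" "\<forall>\<mu>\<in>essential_spectrum \<Omega>. ?m < \<mu>"
      by (auto simp: not_le)
    then have "?m \<in> discrete_spectrum_below_ess \<Omega>"
      using rayleigh_bottom_in_spectrum[OF \<Omega> u]
      unfolding discrete_spectrum_below_ess_def essential_spectrum_def by blast
    then show ?thesis using E by (simp add: is_first_eigenvalue_def)
  qed
  then have "E * (L2_norm \<Omega> u)\<^sup>2 \<le> ?m * (L2_norm \<Omega> u)\<^sup>2" by (intro mult_right_mono) auto
  then show ?thesis using rayleigh_bottom_le[OF u(1)] by simp
qed

lemma first_eigenvalue_ge:
  fixes \<Omega> :: "(real^'n::finite) set"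
  assumes E: "is_first_eigenvalue \<Omega> E"
    and k: "\<And>u. u \<in> H1_0 \<Omega> \<Longrightarrow> k * (L2_norm \<Omega> u)\<^sup>2 \<le> energy \<Omega> u"
  shows "k \<le> E"
proof -
  obtain u :: "real^'n \<Rightarrow> complex" where "dirichlet_laplacian \<Omega> u (\<lambda>x. E * u x)" and nz: "\<not> (AE x in lebesgue_on \<Omega>. u x = 0)"
    using E by (auto simp: is_first_eigenvalue_def discrete_spectrum_below_ess_def
        discrete_spectrum_def is_eigenvalue_def eigenspace_def)
  then have u: "u \<in> H1_0 \<Omega>" and eq: "dirichlet_form \<Omega> u u = L2_inner \<Omega> (\<lambda>x. E * u x) u"
    by (auto simp: dirichlet_laplacian_def)
  have uL: "u \<in> L2 \<Omega>" using H1_D(1)[OF H1_0_H1[OF u]] .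
  have "L2_inner \<Omega> (\<lambda>x. E * u x) u = of_real (E * (L2_norm \<Omega> u)\<^sup>2)"
    using L2_inner_self[of \<Omega> u] by (simp add: L2_inner_def mult.assoc)
  then have "energy \<Omega> u = E * (L2_norm \<Omega> u)\<^sup>2"
    using eq unfolding dirichlet_form_self energy_def[symmetric] by (simp only: of_real_eq_iff)
  moreover have "L2_norm \<Omega> u > 0"
    using nz L2_norm_eq_0_iff[OF uL] L2_norm_nonneg[of \<Omega> u] by linarith
  ultimately show ?thesis using k[OF u] by simp
qed

section \<open>A lower bound from thin fibres\<close>

lemma test_functions_L2_norm:
  assumes "open \<Omega>" "\<phi> \<in> test_functions \<Omega>"
  shows "(L2_norm \<Omega> \<phi>)\<^sup>2 = (LINT x|lborel. (cmod (\<phi> x))\<^sup>2)"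
    and "(L2_norm \<Omega> (pderivative i \<phi>))\<^sup>2 = (LINT x|lborel. (cmod (pderivative i \<phi> x))\<^sup>2)"
    and "integrable lborel (\<lambda>x. (cmod (\<phi> x))\<^sup>2)"
    and "integrable lborel (\<lambda>x. (cmod (pderivative i \<phi> x))\<^sup>2)"
proof -
  obtain K where K: "compact K" "K \<subseteq> \<Omega>" "\<And>x. x \<notin> K \<Longrightarrow> \<phi> x = 0"
    using test_functions_D(2)[OF assms(2)] by auto
  have *: "(L2_norm \<Omega> g)\<^sup>2 = (LINT x|lborel. (cmod (g x))\<^sup>2) \<and> integrable lborel (\<lambda>x. (cmod (g x))\<^sup>2)"
    if g: "\<And>x. x \<notin> K \<Longrightarrow> g x = 0" "continuous_on UNIV g" for g
  proof
    have "(LINT x|lebesgue_on \<Omega>. (cmod (g x))\<^sup>2) = (LINT x|lborel. (cmod (g x))\<^sup>2)"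
      by (rule compact_support_integral(1)[OF assms(1) K(1,2)]) (use g in \<open>auto intro!: continuous_intros\<close>)
    then show "(L2_norm \<Omega> g)\<^sup>2 = (LINT x|lborel. (cmod (g x))\<^sup>2)" by (simp add: L2_norm_def)
    show "integrable lborel (\<lambda>x. (cmod (g x))\<^sup>2)"
      by (rule integrable_compact_support[OF K(1)]) (use g in \<open>auto intro!: continuous_intros\<close>)
  qed
  have "pderivative i \<phi> x = 0" if "x \<notin> K" for x
    using pderivative_support[of K \<phi>] K that by blast
  from *[OF this test_functions_continuous_pderivative[OF assms(2)]]
    *[OF K(3) test_functions_continuous[OF assms(2)]]
  show "(L2_norm \<Omega> \<phi>)\<^sup>2 = (LINT x|lborel. (cmod (\<phi> x))\<^sup>2)"
    and "(L2_norm \<Omega> (pderivative i \<phi>))\<^sup>2 = (LINT x|lborel. (cmod (pderivative i \<phi> x))\<^sup>2)"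
    and "integrable lborel (\<lambda>x. (cmod (\<phi> x))\<^sup>2)"
    and "integrable lborel (\<lambda>x. (cmod (pderivative i \<phi> x))\<^sup>2)" by auto
qed

text \<open>With \<open>c = k cot (k (x\<^sub>i - M))\<close>, the logarithmic derivative of the first Dirichlet mode of the
  fibre, Riccati's equation \<open>\<partial>\<^sub>i c = - k\<^sup>2 - c\<^sup>2\<close> gives
  \<open>\<bar>\<partial>\<^sub>i\<phi>\<bar>\<^sup>2 - k\<^sup>2 \<bar>\<phi>\<bar>\<^sup>2 - \<partial>\<^sub>i (c \<bar>\<phi>\<bar>\<^sup>2) = \<bar>\<partial>\<^sub>i\<phi> - c \<phi>\<bar>\<^sup>2\<close>. Integrated over the
  whole space, the divergence term drops out. Since only \<open>\<partial>\<^sub>i\<close> occurs, \<open>M\<close> may have the kinks of a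
  polyhedral surface.\<close>

lemma fibre_poincare_test:
  fixes \<phi> :: "real^'n::finite \<Rightarrow> complex"
  assumes \<Omega>: "open \<Omega>" and \<phi>: "\<phi> \<in> test_functions \<Omega>"
    and M: "continuous_on UNIV M" "\<And>x t. M (x + t *\<^sub>R axis i 1) = M x"
    and fibre: "\<And>x. x \<in> \<Omega> \<Longrightarrow> 0 < x $ i - M x \<and> x $ i - M x < l"
    and l: "l > 0"
  shows "pi / l * L2_norm \<Omega> \<phi> \<le> L2_norm \<Omega> (pderivative i \<phi>)"
proof -
  define k where "k = pi / l"
  have k: "k > 0" using l by (simp add: k_def)
  obtain K where K: "compact K" "K \<subseteq> \<Omega>" "\<And>x. x \<notin> K \<Longrightarrow> \<phi> x = 0"
    using test_functions_D(2)[OF \<phi>] by auto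
  define p where "p = pderivative i \<phi>"
  define c where "c x = k * cot (k * (x $ i - M x))" for x
  define F where "F x = c x * (\<phi> x \<bullet> \<phi> x)" for x
  define D where "D x = c x * (2 * (\<phi> x \<bullet> p x)) - (k\<^sup>2 + (c x)\<^sup>2) * (\<phi> x \<bullet> \<phi> x)" for x
  have sin: "sin (k * (x $ i - M x)) > 0" if "x \<in> \<Omega>" for x
  proof (rule sin_gt_zero)
    show "0 < k * (x $ i - M x)" using fibre[OF that] k by simp
    have "k * (x $ i - M x) < k * l" using fibre[OF that] k by simp
    then show "k * (x $ i - M x) < pi" using l by (simp add: k_def)
  qed
  have cont: "continuous_on UNIV \<phi>" "continuous_on UNIV p"
    using test_functions_continuous[OF \<phi>] test_functions_continuous_pderivative[OF \<phi>] by (auto simp: p_def)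
  have cc: "continuous_on \<Omega> c"
    unfolding c_def cot_def using sin
    by (intro continuous_intros continuous_on_subset[OF M(1)]) (auto simp: less_imp_neq[symmetric])
  have glue: "continuous_on UNIV g"
    if "continuous_on \<Omega> g" "\<And>x. x \<notin> K \<Longrightarrow> g x = 0" for g :: "real^'n \<Rightarrow> real"
  proof -
    have "continuous_on (- K) g \<longleftrightarrow> continuous_on (- K) (\<lambda>x. 0::real)"
      by (rule continuous_on_cong) (use that(2) in auto)
    then have "continuous_on (\<Omega> \<union> - K) g"
      using that(1) \<Omega> compact_imp_closed[OF K(1)] by (intro continuous_on_open_Un) auto
    moreover have "\<Omega> \<union> - K = UNIV" using K(2) by auto
    ultimately show ?thesis by simp
  qed
  have F0: "F x = 0" and D0: "D x = 0" if "x \<notin> K" for x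
    using K(3)[OF that] by (simp_all add: F_def D_def)
  have FC: "continuous_on UNIV F"
    by (rule glue[OF _ F0]) (auto simp: F_def intro!: continuous_intros cc continuous_on_subset[OF cont(1)])
  have DC: "continuous_on UNIV D"
    by (rule glue[OF _ D0])
      (auto simp: D_def intro!: continuous_intros cc continuous_on_subset[OF cont(1)] continuous_on_subset[OF cont(2)])
  have der: "((\<lambda>t. F (x + t *\<^sub>R axis i 1)) has_vector_derivative D x) (at 0)" for x
  proof (cases "x \<in> \<Omega>")
    case True
    let ?s = "k * (x $ i - M x)"
    have s: "sin (k * ((x $ i + 0) - M x)) \<noteq> 0" using sin[OF True] by simp
    have "((\<lambda>t. k * cot (k * ((x $ i + t) - M x))) has_real_derivative
        k * (- inverse ((sin (k * ((x $ i + 0) - M x)))\<^sup>2) * k)) (at 0)"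
      by (rule DERIV_cmult[OF DERIV_chain2[where g = "\<lambda>t. k * ((x $ i + t) - M x)", OF DERIV_cot[OF s]]]) (auto intro!: derivative_eq_intros)
    moreover have "k * (- inverse ((sin (k * ((x $ i + 0) - M x)))\<^sup>2) * k) = - (k\<^sup>2 + (c x)\<^sup>2)"
    proof -
      have "inverse ((sin ?s)\<^sup>2) = 1 + (cot ?s)\<^sup>2"
        using sin[OF True] sin_cos_squared_add[of ?s]
        by (simp add: cot_def power_divide field_simps)
      then show ?thesis by (simp add: c_def power2_eq_square algebra_simps)
    qed
    ultimately have "((\<lambda>t. k * cot (k * ((x $ i + t) - M x))) has_real_derivative - (k\<^sup>2 + (c x)\<^sup>2)) (at 0)"
      by simp
    moreover have "((\<lambda>t. \<phi> (x + t *\<^sub>R axis i 1) \<bullet> \<phi> (x + t *\<^sub>R axis i 1)) has_real_derivative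
        2 * (\<phi> x \<bullet> p x)) (at 0)"
      unfolding has_real_derivative_iff_has_vector_derivative
    proof -
      have v: "((\<lambda>t. \<phi> (x + t *\<^sub>R axis i 1)) has_vector_derivative p x) (at 0)"
        unfolding p_def by (rule pderivative_along_axis[OF test_functions_differentiable[OF \<phi>]])
      from bounded_bilinear.has_vector_derivative[OF bounded_bilinear_inner v v]
      show "((\<lambda>t. \<phi> (x + t *\<^sub>R axis i 1) \<bullet> \<phi> (x + t *\<^sub>R axis i 1)) has_vector_derivative
        2 * (\<phi> x \<bullet> p x)) (at 0)" by (simp add: inner_commute)
    qed
    ultimately have "((\<lambda>t. k * cot (k * ((x $ i + t) - M x)) * (\<phi> (x + t *\<^sub>R axis i 1) \<bullet> \<phi> (x + t *\<^sub>R axis i 1)))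
        has_real_derivative D x) (at 0)"
      by (rule DERIV_cong[OF DERIV_mult]) (simp add: D_def c_def algebra_simps)
    moreover have "(\<lambda>t. F (x + t *\<^sub>R axis i 1)) =
        (\<lambda>t. k * cot (k * ((x $ i + t) - M x)) * (\<phi> (x + t *\<^sub>R axis i 1) \<bullet> \<phi> (x + t *\<^sub>R axis i 1)))"
      by (simp add: F_def c_def M(2))
    ultimately show ?thesis by (simp add: has_real_derivative_iff_has_vector_derivative)
  next
    case False
    define S where "S = (\<lambda>t::real. x + t *\<^sub>R axis i 1) -` (- K)"
    have "open S" unfolding S_def
      using compact_imp_closed[OF K(1)] by (intro open_vimage) (auto intro!: continuous_intros)
    moreover have "0 \<in> S" using False K(2) by (auto simp: S_def)
    ultimately have "((\<lambda>t. F (x + t *\<^sub>R axis i 1)) has_vector_derivative 0) (at 0)"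
      by (rule has_vector_derivative_transform_within_open[OF has_vector_derivative_const])
        (simp add: S_def F0)
    moreover have "D x = 0" using False K(2) by (intro D0) auto
    ultimately show ?thesis by simp
  qed
  note D = integral_directional_derivative[OF K(1) F0 FC DC der]
  note I = test_functions_L2_norm[OF \<Omega> \<phi>]
  have "0 \<le> (LINT x|lborel. (cmod (p x))\<^sup>2 - k\<^sup>2 * (cmod (\<phi> x))\<^sup>2 - D x)"
  proof (rule integral_nonneg_AE, rule AE_I2)
    fix x
    have "(cmod (p x))\<^sup>2 - k\<^sup>2 * (cmod (\<phi> x))\<^sup>2 - D x = (p x - c x *\<^sub>R \<phi> x) \<bullet> (p x - c x *\<^sub>R \<phi> x)"
      unfolding power2_norm_eq_inner D_def
      by (simp add: inner_diff_left inner_diff_right inner_commute[of "p x" "\<phi> x"] power2_eq_square algebra_simps)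
    then show "0 \<le> (cmod (p x))\<^sup>2 - k\<^sup>2 * (cmod (\<phi> x))\<^sup>2 - D x" by simp
  qed
  also have "\<dots> = (L2_norm \<Omega> p)\<^sup>2 - k\<^sup>2 * (L2_norm \<Omega> \<phi>)\<^sup>2"
    using D I by (simp add: p_def)
  finally have "(k * L2_norm \<Omega> \<phi>)\<^sup>2 \<le> (L2_norm \<Omega> p)\<^sup>2" by (simp add: power_mult_distrib)
  then show ?thesis
    unfolding k_def[symmetric] p_def[symmetric] by (rule power2_le_imp_le) (rule L2_norm_nonneg)
qed

text \<open>Both sides are continuous for the \<open>H\<^sup>1\<close> norm.\<close>

lemma H1_0_poincare:
  assumes \<Omega>: "open \<Omega>" and u: "u \<in> H1_0 \<Omega>" and k: "k \<ge> 0"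
    and test: "\<And>\<phi>. \<phi> \<in> test_functions \<Omega> \<Longrightarrow> k * L2_norm \<Omega> \<phi> \<le> L2_norm \<Omega> (pderivative i \<phi>)"
  shows "k * L2_norm \<Omega> u \<le> L2_norm \<Omega> (weak_partial \<Omega> i u)"
proof -
  have *: "k * L2_norm \<Omega> u \<le> L2_norm \<Omega> (weak_partial \<Omega> i u) + (1 + k) * \<epsilon>" if \<epsilon>: "\<epsilon> > 0" for \<epsilon>
  proof -
    obtain \<phi> where \<phi>: "\<phi> \<in> test_functions \<Omega>" "H1_norm \<Omega> (\<lambda>x. u x - \<phi> x) < \<epsilon>"
      using u \<epsilon> unfolding H1_0_def by blast
    let ?d = "\<lambda>x. u x - \<phi> x"
    have uH: "u \<in> H1 \<Omega>" and \<phi>H: "\<phi> \<in> H1 \<Omega>"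
      using H1_0_H1[OF u] test_functions_H1(1)[OF \<Omega> \<phi>(1)] by auto
    have dH: "?d \<in> H1 \<Omega>" using H1_add(1)[OF \<Omega> uH \<phi>H, of "-1"] by simp
    have "L2_norm \<Omega> u \<le> L2_norm \<Omega> \<phi> + L2_norm \<Omega> ?d"
      using L2_triangle[OF H1_D(1)[OF \<phi>H] H1_D(1)[OF dH], of 1] by simp
    then have a: "L2_norm \<Omega> u \<le> L2_norm \<Omega> \<phi> + \<epsilon>"
      using H1_norm_bounds(1)[of \<Omega> ?d] \<phi>(2) by linarith
    have "L2_norm \<Omega> (weak_partial \<Omega> i \<phi>) \<le> L2_norm \<Omega> (weak_partial \<Omega> i u) + L2_norm \<Omega> (weak_partial \<Omega> i ?d)"
      using weak_partial_norm_add[OF \<Omega> uH dH, where i = i and c = "-1"] by simp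
    then have b: "L2_norm \<Omega> (weak_partial \<Omega> i \<phi>) \<le> L2_norm \<Omega> (weak_partial \<Omega> i u) + \<epsilon>"
      using H1_norm_bounds(2)[of \<Omega> ?d i] \<phi>(2) by linarith
    have "L2_norm \<Omega> (weak_partial \<Omega> i \<phi>) = L2_norm \<Omega> (pderivative i \<phi>)"
      by (intro L2_norm_cong_AE test_functions_H1(2) \<Omega> \<phi> L2_D(1)[OF H1_D(3)[OF \<phi>H]]
          L2_D(1)[OF test_functions_L2(2)[OF \<Omega> \<phi>(1)]])
    then have "k * L2_norm \<Omega> \<phi> \<le> L2_norm \<Omega> (weak_partial \<Omega> i u) + \<epsilon>"
      using test[OF \<phi>(1)] b by simp
    moreover have "k * L2_norm \<Omega> u \<le> k * (L2_norm \<Omega> \<phi> + \<epsilon>)" using a k by (rule mult_left_mono)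
    ultimately show ?thesis by (simp add: algebra_simps)
  qed
  show ?thesis
  proof (rule field_le_epsilon)
    fix e :: real assume "e > 0"
    then show "k * L2_norm \<Omega> u \<le> L2_norm \<Omega> (weak_partial \<Omega> i u) + e"
      using *[of "e / (1 + k)"] k by simp
  qed
qed

lemma first_eigenvalue_ge_fibre_width:
  fixes \<Omega> :: "(real^'n::finite) set"
  assumes \<Omega>: "open \<Omega>" and E: "is_first_eigenvalue \<Omega> E"
    and M: "continuous_on UNIV M" "\<And>x t. M (x + t *\<^sub>R axis i 1) = M x"
    and fibre: "\<And>x. x \<in> \<Omega> \<Longrightarrow> 0 < x $ i - M x \<and> x $ i - M x < l"
    and l: "l > 0"
  shows "(pi / l)\<^sup>2 \<le> E"
proof (rule first_eigenvalue_ge[OF E])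
  fix u assume u: "u \<in> H1_0 \<Omega>"
  have "pi / l * L2_norm \<Omega> u \<le> L2_norm \<Omega> (weak_partial \<Omega> i u)"
    by (rule H1_0_poincare[OF \<Omega> u _ fibre_poincare_test[OF \<Omega> _ M fibre l]]) (use l in auto)
  then have "(pi / l * L2_norm \<Omega> u)\<^sup>2 \<le> (L2_norm \<Omega> (weak_partial \<Omega> i u))\<^sup>2"
    using l L2_norm_nonneg[of \<Omega> u] by (intro power_mono) auto
  also have "\<dots> \<le> energy \<Omega> u" unfolding energy_def by (rule member_le_sum) auto
  finally show "(pi / l)\<^sup>2 * (L2_norm \<Omega> u)\<^sup>2 \<le> energy \<Omega> u" by (simp only: power_mult_distrib)
qed

section \<open>An upper bound from boxes\<close>

definition cutoff_deriv :: "real \<Rightarrow> real \<Rightarrow> nat \<Rightarrow> real \<Rightarrow> real" where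
  "cutoff_deriv a b n t =
    real n * (bump (real n * (t - a) - 1) / (real n * (t - a) - 1)\<^sup>2) * bump (real n * (b - t) - 1)
    - bump (real n * (t - a) - 1) * (real n * (bump (real n * (b - t) - 1) / (real n * (b - t) - 1)\<^sup>2))"

lemma cutoff_has_derivative:
  "(cutoff a b n has_real_derivative cutoff_deriv a b n t) (at t)"
proof -
  have "((\<lambda>t. bump (real n * (t - a) - 1)) has_real_derivative
      bump (real n * (t - a) - 1) / (real n * (t - a) - 1)\<^sup>2 * real n) (at t)"
    by (rule DERIV_chain2[OF bump_deriv]) (auto intro!: derivative_eq_intros)
  moreover have "((\<lambda>t. bump (real n * (b - t) - 1)) has_real_derivative
      bump (real n * (b - t) - 1) / (real n * (b - t) - 1)\<^sup>2 * (- real n)) (at t)"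
    by (rule DERIV_chain2[OF bump_deriv]) (auto intro!: derivative_eq_intros)
  ultimately have "((\<lambda>t. bump (real n * (t - a) - 1) * bump (real n * (b - t) - 1)) has_real_derivative
      cutoff_deriv a b n t) (at t)"
    by (rule DERIV_cong[OF DERIV_mult]) (simp add: cutoff_deriv_def mult_ac)
  then show ?thesis by (simp add: cutoff_def[abs_def])
qed

text \<open>The product of the distance to an end point with the slope of the cutoff there: it is bounded
  uniformly in \<open>n\<close> and, the slope living at distance of order \<open>1 / n\<close>, tends to zero pointwise.\<close>

definition slope :: "real \<Rightarrow> real" where
  "slope y = y * (bump (y - 1) / (y - 1)\<^sup>2)"

lemma slope_bounds:
  assumes "y > 0"
  shows "0 \<le> slope y" "slope y \<le> 2"
proof -
  show "0 \<le> slope y" using assms by (simp add: slope_def bump_bounds)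
  show "slope y \<le> 2"
  proof (cases "y > 1")
    case True
    define u where "u = 1 / (y - 1)"
    have u: "u > 0" using True by (simp add: u_def)
    have y: "y = 1 / u + 1" "y - 1 = 1 / u" using True by (simp_all add: u_def)
    have "slope y = (u + u\<^sup>2) * exp (- u)"
      using True u unfolding slope_def y(2) by (subst y(1)) (simp add: bump_def field_simps power2_eq_square)
    also have "\<dots> \<le> 2 * exp u * exp (- u)"
      using exp_lower_Taylor_quadratic[of u] u by (intro mult_right_mono) auto
    finally show ?thesis by (simp add: mult.assoc exp_minus_inverse)
  qed (simp add: slope_def bump_def)
qed

lemma slope_scaled_tendsto:
  assumes "t > 0"
  shows "(\<lambda>n. slope (real n * t)) \<longlonglongrightarrow> 0"
proof -
  have "(\<lambda>n. (real n * t) * (exp (- (1 / (real n * t - 1))) / (real n * t - 1)\<^sup>2)) \<longlonglongrightarrow> 0"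
    using assms by real_asymp
  moreover have "\<forall>\<^sub>F n in sequentially. real n * t - 1 > 0"
    using assms by real_asymp
  then have "\<forall>\<^sub>F n in sequentially. (real n * t) * (exp (- (1 / (real n * t - 1))) / (real n * t - 1)\<^sup>2)
      = slope (real n * t)"
    by eventually_elim (simp add: slope_def bump_def)
  ultimately show ?thesis by (rule Lim_transform_eventually)
qed

lemma sine_times_slope:
  assumes t: "t \<in> {a<..<b}"
  defines "k \<equiv> pi / (b - a)"
  shows "\<bar>sin (k * (t - a)) * cutoff_deriv a b n t\<bar> \<le> k * (slope (real n * (t - a)) + slope (real n * (b - t)))"
proof -
  have k: "k > 0" using t by (simp add: k_def)
  have s1: "\<bar>sin (k * (t - a))\<bar> \<le> k * (t - a)"
    using abs_sin_x_le_abs_x[of "k * (t - a)"] t k by (simp add: abs_mult)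
  have "k * (t - a) = pi - k * (b - t)" using t by (simp add: k_def field_simps)
  then have "sin (k * (t - a)) = sin (k * (b - t))" by simp
  then have s2: "\<bar>sin (k * (t - a))\<bar> \<le> k * (b - t)"
    using abs_sin_x_le_abs_x[of "k * (b - t)"] t k by (simp add: abs_mult)
  let ?A = "bump (real n * (t - a) - 1)" and ?B = "bump (real n * (b - t) - 1)"
  let ?A' = "real n * (?A / (real n * (t - a) - 1)\<^sup>2)" and ?B' = "real n * (?B / (real n * (b - t) - 1)\<^sup>2)"
  have nn: "0 \<le> ?A" "0 \<le> ?B" "?A \<le> 1" "?B \<le> 1" "0 \<le> ?A'" "0 \<le> ?B'"
    by (simp_all add: bump_bounds)
  have "\<bar>cutoff_deriv a b n t\<bar> \<le> ?A' * ?B + ?A * ?B'"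
    unfolding cutoff_deriv_def using nn by (intro order.trans[OF abs_triangle_ineq4]) (simp add: abs_mult)
  also have "\<dots> \<le> ?A' + ?B'"
    using nn by (intro add_mono mult_left_le mult_left_le_one_le) auto
  finally have "\<bar>sin (k * (t - a)) * cutoff_deriv a b n t\<bar> \<le> \<bar>sin (k * (t - a))\<bar> * (?A' + ?B')"
    unfolding abs_mult by (intro mult_left_mono) auto
  also have "\<dots> \<le> (k * (t - a)) * ?A' + (k * (b - t)) * ?B'"
    unfolding distrib_left using nn s1 s2 by (intro add_mono mult_right_mono) auto
  also have "\<dots> = k * (slope (real n * (t - a)) + slope (real n * (b - t)))"
    by (simp add: slope_def algebra_simps)
  finally show ?thesis .
qed

text \<open>The first Dirichlet eigenfunction of the box.\<close>

definition box_mode :: "real^'n::finite \<Rightarrow> real^'n \<Rightarrow> real^'n \<Rightarrow> real" where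
  "box_mode a b x = (\<Prod>i\<in>UNIV. sin (pi / (b $ i - a $ i) * (x $ i - a $ i)))"

lemma prod_along_axis:
  fixes h :: "'n::finite \<Rightarrow> real \<Rightarrow> real"
  shows "(\<Prod>i\<in>UNIV. h i ((x + t *\<^sub>R axis j 1) $ i)) = h j (x $ j + t) * (\<Prod>i\<in>UNIV - {j}. h i (x $ i))"
proof -
  have "(\<Prod>i\<in>UNIV. h i ((x + t *\<^sub>R axis j 1) $ i))
      = h j ((x + t *\<^sub>R axis j 1) $ j) * (\<Prod>i\<in>UNIV - {j}. h i ((x + t *\<^sub>R axis j 1) $ i))"
    by (rule prod.remove) auto
  also have "(\<Prod>i\<in>UNIV - {j}. h i ((x + t *\<^sub>R axis j 1) $ i)) = (\<Prod>i\<in>UNIV - {j}. h i (x $ i))"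
    by (intro prod.cong) (auto simp: axis_def)
  finally show ?thesis by simp
qed

lemma prod_axis_derivative:
  fixes h :: "'n::finite \<Rightarrow> real \<Rightarrow> real"
  assumes "(h j has_real_derivative d) (at (x $ j))"
  shows "((\<lambda>t. \<Prod>i\<in>UNIV. h i ((x + t *\<^sub>R axis j 1) $ i)) has_real_derivative
    d * (\<Prod>i\<in>UNIV - {j}. h i (x $ i))) (at 0)"
proof -
  have "((\<lambda>t. h j (x $ j + t)) has_real_derivative d * 1) (at 0)"
    by (rule DERIV_chain2[where f = "h j" and g = "\<lambda>t. x $ j + t"])
      (use assms in \<open>auto intro!: derivative_eq_intros\<close>)
  then show ?thesis unfolding prod_along_axis by (auto intro!: derivative_eq_intros)
qed

lemma box_mode_Ck: "Ck k (\<lambda>x. complex_of_real (box_mode a b x))"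
  unfolding box_mode_def of_real_prod
proof (intro Ck_prod)
  fix i
  have "smooth (\<lambda>t. sin (pi / (b $ i - a $ i) * t + (- (pi / (b $ i - a $ i) * a $ i))))"
    by (intro smooth_affine smooth_sin)
  from smooth_Ck_coordinate[OF this, of k i]
  show "Ck k (\<lambda>x. complex_of_real (sin (pi / (b $ i - a $ i) * (x $ i - a $ i))))"
    by (simp add: algebra_simps diff_divide_distrib)
qed

lemma box_mode_bounds:
  "\<bar>box_mode a b x\<bar> \<le> \<bar>sin (pi / (b $ j - a $ j) * (x $ j - a $ j))\<bar>" "\<bar>box_mode a b x\<bar> \<le> 1"
proof -
  have p: "(\<Prod>i\<in>I. \<bar>sin (pi / (b $ i - a $ i) * (x $ i - a $ i))\<bar>) \<le> 1" for I
    by (intro prod_le_1) auto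
  show "\<bar>box_mode a b x\<bar> \<le> 1" unfolding box_mode_def abs_prod by (rule p)
  show "\<bar>box_mode a b x\<bar> \<le> \<bar>sin (pi / (b $ j - a $ j) * (x $ j - a $ j))\<bar>"
    unfolding box_mode_def abs_prod by (subst prod.remove[of _ j], simp, simp, rule mult_left_le[OF p], simp)
qed

lemma box_mode_pos:
  assumes "x \<in> box a b"
  shows "box_mode a b x > 0"
  unfolding box_mode_def
proof (rule prod_pos)
  fix i
  have i: "a $ i < x $ i" "x $ i < b $ i" using assms by (auto simp: mem_box_cart)
  then show "0 < sin (pi / (b $ i - a $ i) * (x $ i - a $ i))"
    by (intro sin_gt_zero) (auto simp: field_simps)
qed

text \<open>The slope of the cutoff is concentrated near the faces of the box, where the mode is small.\<close>

lemma box_mode_times_slope: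
  fixes a b :: "real^'n::finite" and j :: 'n
  assumes x: "x \<in> box a b" and w: "\<bar>w\<bar> \<le> 1"
  defines "k \<equiv> pi / (b $ j - a $ j)"
  shows "\<bar>box_mode a b x * (cutoff_deriv (a $ j) (b $ j) n (x $ j) * w)\<bar>
    \<le> k * (slope (real n * (x $ j - a $ j)) + slope (real n * (b $ j - x $ j)))"
proof -
  have j: "x $ j \<in> {a $ j<..<b $ j}" using x by (auto simp: mem_box_cart)
  have "\<bar>box_mode a b x * (cutoff_deriv (a $ j) (b $ j) n (x $ j) * w)\<bar>
      \<le> \<bar>box_mode a b x * cutoff_deriv (a $ j) (b $ j) n (x $ j)\<bar>"
    using w by (simp add: abs_mult mult.assoc[symmetric] mult_left_le)
  also have "\<dots> \<le> \<bar>sin (k * (x $ j - a $ j)) * cutoff_deriv (a $ j) (b $ j) n (x $ j)\<bar>"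
    unfolding abs_mult k_def by (intro mult_right_mono box_mode_bounds(1)) auto
  also have "\<dots> \<le> k * (slope (real n * (x $ j - a $ j)) + slope (real n * (b $ j - x $ j)))"
    unfolding k_def by (rule sine_times_slope[OF j])
  finally show ?thesis .
qed

lemma pderivative_of_real:
  assumes "(\<lambda>x. complex_of_real (f x)) differentiable (at x)"
    and "((\<lambda>t. f (x + t *\<^sub>R axis j 1)) has_real_derivative d) (at 0)"
  shows "pderivative j (\<lambda>x. complex_of_real (f x)) x = complex_of_real d"
  using pderivative_along_axis[OF assms(1)]
    has_vector_derivative_of_real[OF assms(2)]
  by (rule vector_derivative_unique_at)

lemma test_functions_energy:
  assumes "open \<Omega>" "\<phi> \<in> test_functions \<Omega>"
  shows "energy \<Omega> \<phi> = (\<Sum>i\<in>UNIV. LINT x|lborel. (cmod (pderivative i \<phi> x))\<^sup>2)"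
proof -
  have "L2_norm \<Omega> (weak_partial \<Omega> i \<phi>) = L2_norm \<Omega> (pderivative i \<phi>)" for i
    by (intro L2_norm_cong_AE test_functions_H1(2) assms
        L2_D(1)[OF H1_D(3)[OF test_functions_H1(1)[OF assms]]] L2_D(1)[OF test_functions_L2(2)[OF assms]])
  then show ?thesis by (simp add: energy_def test_functions_L2_norm[OF assms])
qed

text \<open>The trial functions are the first mode \<open>s\<close> of the box times cutoffs \<open>w\<close>. The identity
  \<open>\<integral>\<bar>\<partial>\<^sub>j(s w)\<bar>\<^sup>2 = k\<^sub>j\<^sup>2 \<integral>s\<^sup>2 w\<^sup>2 + \<integral>s\<^sup>2 \<bar>\<partial>\<^sub>jw\<bar>\<^sup>2\<close> isolates the eigenvalue of the box exactly and leaves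
  the error \<open>s\<^sup>2 \<bar>\<partial>\<^sub>jw\<bar>\<^sup>2\<close>, which tends to zero by dominated convergence.\<close>

lemma first_eigenvalue_le_box:
  fixes \<Omega> :: "(real^'n::finite) set"
  assumes \<Omega>: "open \<Omega>" and E: "is_first_eigenvalue \<Omega> E"
    and ab: "\<And>i. a $ i < b $ i" and sub: "box a b \<subseteq> \<Omega>"
  shows "E \<le> (\<Sum>i\<in>UNIV. (pi / (b $ i - a $ i))\<^sup>2)"
proof -
  define k where "k i = pi / (b $ i - a $ i)" for i
  define \<mu> where "\<mu> = (\<Sum>i\<in>UNIV. (k i)\<^sup>2)"
  have k: "k i > 0" for i using ab[of i] by (simp add: k_def)
  define s where "s = box_mode a b"
  define w where "w n = box_cutoff a b (Suc n)" for n
  define sd where "sd j x = (\<Prod>i\<in>UNIV. if i = j then k j * cos (k j * (x $ j - a $ j))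
      else sin (k i * (x $ i - a $ i)))" for j x
  define wd where "wd n j x = cutoff_deriv (a $ j) (b $ j) (Suc n) (x $ j) *
      (\<Prod>i\<in>UNIV - {j}. cutoff (a $ i) (b $ i) (Suc n) (x $ i))" for n j x
  define \<phi> where "\<phi> n = (\<lambda>x. complex_of_real (s x * w n x))" for n

  have s_Ck: "Ck m (\<lambda>x. complex_of_real (s x))" and w_Ck: "Ck m (\<lambda>x. complex_of_real (w n x))" for m n
    by (simp_all add: s_def w_def box_mode_Ck box_cutoff_Ck)
  have Re_cont: "continuous_on UNIV f" if "continuous_on UNIV (\<lambda>x. complex_of_real (f x))" for f :: "real^'n \<Rightarrow> real"
    using continuous_on_Re[OF that] by simp
  have s_cont: "continuous_on UNIV s" and w_cont: "continuous_on UNIV (w n)" for n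
    using s_Ck[of 0] w_Ck[of 0 n] by (auto intro: Re_cont)
  have sd_cont: "continuous_on UNIV (sd j)" for j
  proof -
    have "continuous_on UNIV (\<lambda>x::real^'n. if i = j then k j * cos (k j * (x $ j - a $ j))
        else sin (k i * (x $ i - a $ i)))" for i
      by (cases "i = j") (auto intro!: continuous_intros)
    then show ?thesis unfolding sd_def by (intro continuous_on_prod)
  qed

  have s_der: "((\<lambda>t. s (x + t *\<^sub>R axis j 1)) has_real_derivative sd j x) (at 0)" for x j
  proof -
    have "((\<lambda>t. sin (k j * (t - a $ j))) has_real_derivative k j * cos (k j * (x $ j - a $ j))) (at (x $ j))"
      by (auto intro!: derivative_eq_intros)
    from prod_axis_derivative[where h = "\<lambda>i t. sin (k i * (t - a $ i))", OF this]
    show ?thesis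
      by (simp add: s_def box_mode_def sd_def k_def[symmetric] prod.remove[of UNIV j])
  qed
  have sd_der: "((\<lambda>t. sd j (x + t *\<^sub>R axis j 1)) has_real_derivative - (k j)\<^sup>2 * s x) (at 0)" for x j
  proof -
    let ?h = "\<lambda>i t. if i = j then k j * cos (k j * (t - a $ j)) else sin (k i * (t - a $ i))"
    have "((\<lambda>t. ?h j t) has_real_derivative - (k j)\<^sup>2 * sin (k j * (x $ j - a $ j))) (at (x $ j))"
      by (auto intro!: derivative_eq_intros simp: power2_eq_square)
    from prod_axis_derivative[where h = ?h, OF this]
    have "((\<lambda>t. \<Prod>i\<in>UNIV. ?h i ((x + t *\<^sub>R axis j 1) $ i)) has_real_derivative
      - (k j)\<^sup>2 * sin (k j * (x $ j - a $ j)) * (\<Prod>i\<in>UNIV - {j}. ?h i (x $ i))) (at 0)" .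
    moreover have "(\<Prod>i\<in>UNIV. ?h i (y $ i)) = sd j y" for y
      unfolding sd_def by (intro prod.cong) auto
    moreover have "- (k j)\<^sup>2 * sin (k j * (x $ j - a $ j)) * (\<Prod>i\<in>UNIV - {j}. ?h i (x $ i)) = - (k j)\<^sup>2 * s x"
      by (simp add: s_def box_mode_def k_def[symmetric] prod.remove[of UNIV j])
    ultimately show ?thesis by (simp only:)
  qed
  have w_der: "((\<lambda>t. w n (x + t *\<^sub>R axis j 1)) has_real_derivative wd n j x) (at 0)" for n x j
    unfolding w_def wd_def box_cutoff_def
    by (rule prod_axis_derivative[where h = "\<lambda>i. cutoff (a $ i) (b $ i) (Suc n)"]) (rule cutoff_has_derivative)
  have wd_pderiv: "pderivative j (\<lambda>x. complex_of_real (w n x)) x = complex_of_real (wd n j x)" for n j x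
    using Ck_differentiable[OF w_Ck] w_der by (rule pderivative_of_real)
  have wd_cont: "continuous_on UNIV (wd n j)" for n j
  proof (rule Re_cont)
    have "pderivative j (\<lambda>x. complex_of_real (w n x)) = (\<lambda>x. complex_of_real (wd n j x))"
      by (rule ext) (rule wd_pderiv)
    moreover have "continuous_on UNIV (pderivative j (\<lambda>x. complex_of_real (w n x)))"
      using w_Ck[of "Suc 0" n] by simp
    ultimately show "continuous_on UNIV (\<lambda>x. complex_of_real (wd n j x))" by simp
  qed

  have supp: "\<exists>K. compact K \<and> K \<subseteq> box a b \<and> (\<forall>x. x \<notin> K \<longrightarrow> w n x = 0 \<and> wd n j x = 0)" for n j
  proof -
    obtain K where K: "compact K" "K \<subseteq> box a b" "\<And>x. x \<notin> K \<Longrightarrow> w n x = 0"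
      using box_cutoff_support[of "Suc n" a b] by (auto simp: w_def)
    have "wd n j x = 0" if "x \<notin> K" for x
      using pderivative_support[of K "\<lambda>x. complex_of_real (w n x)" x j] K that by (simp add: wd_pderiv)
    then show ?thesis using K by blast
  qed
  have \<phi>_Ck: "Ck m (\<phi> n)" for m n
    using Ck_mult[OF s_Ck[of m] w_Ck[of m n]] by (simp add: \<phi>_def)
  have \<phi>_test: "\<phi> n \<in> test_functions \<Omega>" for n
  proof -
    obtain K where K: "compact K" "K \<subseteq> box a b" "\<And>x. x \<notin> K \<Longrightarrow> w n x = 0"
      using box_cutoff_support[of "Suc n" a b] by (auto simp: w_def)
    show ?thesis
    proof (rule test_functions_I[OF \<phi>_Ck K(1)])
      show "K \<subseteq> \<Omega>" using K(2) sub by (rule order.trans)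
      show "\<phi> n x = 0" if "x \<notin> K" for x using K(3)[OF that] by (simp add: \<phi>_def)
    qed
  qed
  have \<phi>_pderiv: "pderivative j (\<phi> n) x = complex_of_real (sd j x * w n x + s x * wd n j x)" for n j x
  proof -
    have "((\<lambda>t. s (x + t *\<^sub>R axis j 1) * w n (x + t *\<^sub>R axis j 1)) has_real_derivative
        sd j x * w n x + s x * wd n j x) (at 0)"
      by (rule DERIV_cong[OF DERIV_mult[OF s_der w_der]]) (simp add: algebra_simps)
    from pderivative_of_real[OF Ck_differentiable[OF \<phi>_Ck[of "Suc 0" n, unfolded \<phi>_def]] this]
    show ?thesis unfolding \<phi>_def .
  qed

  have err_int: "integrable lborel (\<lambda>x. (s x * wd n j x)\<^sup>2)" for n j
  proof -
    obtain K where "compact K" "\<forall>x. x \<notin> K \<longrightarrow> wd n j x = 0" using supp[of n j] by blast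
    then show ?thesis
      by (intro integrable_compact_support[of K] continuous_intros s_cont wd_cont) auto
  qed
  have mass_int: "integrable lborel (\<lambda>x. (s x * w n x)\<^sup>2)" for n
    using test_functions_L2_norm(3)[OF \<Omega> \<phi>_test[of n]] by (simp add: \<phi>_def flip: of_real_mult)

  \<comment> \<open>the cross term and \<open>\<partial>\<^sub>j\<^sup>2 s = - k\<^sub>j\<^sup>2 s\<close> combine into the derivative of \<open>s \<partial>\<^sub>js w\<^sup>2\<close>\<close>
  have split: "(LINT x|lborel. (cmod (pderivative j (\<phi> n) x))\<^sup>2)
      = (k j)\<^sup>2 * (LINT x|lborel. (s x * w n x)\<^sup>2) + (LINT x|lborel. (s x * wd n j x)\<^sup>2)" for n j
  proof -
    obtain K where K: "compact K" "\<And>x. x \<notin> K \<Longrightarrow> w n x = 0 \<and> wd n j x = 0" using supp[of n j] by blast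
    define F where "F x = s x * sd j x * (w n x)\<^sup>2" for x
    define D where "D x = ((sd j x)\<^sup>2 - (k j)\<^sup>2 * (s x)\<^sup>2) * (w n x)\<^sup>2 + 2 * s x * sd j x * w n x * wd n j x" for x
    have der: "((\<lambda>t. F (x + t *\<^sub>R axis j 1)) has_vector_derivative D x) (at 0)" for x
    proof -
      have "((\<lambda>t. s (x + t *\<^sub>R axis j 1) * sd j (x + t *\<^sub>R axis j 1) *
          (w n (x + t *\<^sub>R axis j 1) * w n (x + t *\<^sub>R axis j 1))) has_real_derivative D x) (at 0)"
        by (rule DERIV_cong[OF DERIV_mult[OF DERIV_mult[OF s_der sd_der] DERIV_mult[OF w_der w_der]]])
          (simp add: D_def power2_eq_square algebra_simps)
      then show ?thesis
        by (simp add: F_def power2_eq_square has_real_derivative_iff_has_vector_derivative)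
    qed
    have FC: "continuous_on UNIV F" and DC: "continuous_on UNIV D"
      unfolding F_def D_def by (intro continuous_intros s_cont sd_cont w_cont wd_cont)+
    have F0: "F x = 0" if "x \<notin> K" for x using K(2)[OF that] by (simp add: F_def)
    note D = integral_directional_derivative[OF K(1) F0 FC DC der]
    have "(cmod (pderivative j (\<phi> n) x))\<^sup>2 = D x + ((k j)\<^sup>2 * (s x * w n x)\<^sup>2 + (s x * wd n j x)\<^sup>2)" for x
      unfolding \<phi>_pderiv norm_of_real power2_abs by (simp add: D_def power2_eq_square algebra_simps)
    then show ?thesis using D err_int[of n j] mass_int[of n] by simp
  qed

  have bound: "(E - \<mu>) * (LINT x|lborel. (s x * w n x)\<^sup>2) \<le> (\<Sum>j\<in>UNIV. LINT x|lborel. (s x * wd n j x)\<^sup>2)" for n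
  proof -
    have m: "(L2_norm \<Omega> (\<phi> n))\<^sup>2 = (LINT x|lborel. (s x * w n x)\<^sup>2)"
      using test_functions_L2_norm(1)[OF \<Omega> \<phi>_test[of n]] by (simp add: \<phi>_def flip: of_real_mult)
    have e: "energy \<Omega> (\<phi> n) = \<mu> * (LINT x|lborel. (s x * w n x)\<^sup>2) + (\<Sum>j\<in>UNIV. LINT x|lborel. (s x * wd n j x)\<^sup>2)"
      by (simp add: test_functions_energy[OF \<Omega> \<phi>_test] split sum.distrib \<mu>_def sum_distrib_right)
    show ?thesis
    proof (cases "L2_norm \<Omega> (\<phi> n) = 0")
      case True
      then show ?thesis using m by (simp add: sum_nonneg)
    next
      case False
      then show ?thesis
        using first_eigenvalue_le_rayleigh_quotient[OF \<Omega> E test_functions_H1_0[OF \<Omega> \<phi>_test] False] m e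
        by (simp add: algebra_simps)
    qed
  qed

  have box_int: "integrable lborel (\<lambda>x. c * indicator (box a b) x)" for c :: real
    by (intro integrable_mult_right integrable_real_indicator emeasure_lborel_box_finite) auto
  have mass_lim: "(\<lambda>n. LINT x|lborel. (s x * w n x)\<^sup>2) \<longlonglongrightarrow> (LINT x|lborel. (s x * indicator (box a b) x)\<^sup>2)"
  proof (rule integral_dominated_convergence[OF _ _ box_int[of 1]])
    show "(\<lambda>x. (s x * indicator (box a b) x)\<^sup>2) \<in> borel_measurable lborel"
      using borel_measurable_continuous_onI[OF s_cont] by measurable
    show "(\<lambda>x. (s x * w n x)\<^sup>2) \<in> borel_measurable lborel" for n
      using mass_int by (rule borel_measurable_integrable)
    show "AE x in lborel. (\<lambda>n. (s x * w n x)\<^sup>2) \<longlonglongrightarrow> (s x * indicator (box a b) x)\<^sup>2"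
      unfolding w_def by (intro AE_I2 tendsto_intros LIMSEQ_Suc box_cutoff_tendsto)
    show "AE x in lborel. norm ((s x * w n x)\<^sup>2) \<le> 1 * indicator (box a b) x" for n
    proof (rule AE_I2)
      fix x
      show "norm ((s x * w n x)\<^sup>2) \<le> 1 * indicator (box a b) x"
      proof (cases "x \<in> box a b")
        case True
        have "\<bar>s x * w n x\<bar> \<le> 1"
          unfolding abs_mult s_def w_def
          using box_mode_bounds(2)[of a b x] box_cutoff_bounds[of a b "Suc n" x] by (intro mult_le_one) auto
        then have "\<bar>s x * w n x\<bar>\<^sup>2 \<le> 1\<^sup>2" by (intro power_mono) auto
        then show ?thesis using True by simp
      qed (simp add: w_def box_cutoff_zero)
    qed
  qed
  have err_lim: "(\<lambda>n. LINT x|lborel. (s x * wd n j x)\<^sup>2) \<longlonglongrightarrow> 0" for j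
  proof -
    define g where "g n x = k j * (slope (real (Suc n) * (x $ j - a $ j)) + slope (real (Suc n) * (b $ j - x $ j)))" for n x
    have le: "\<bar>s x * wd n j x\<bar> \<le> g n x" if "x \<in> box a b" for n x
      unfolding s_def wd_def g_def k_def
    proof (rule box_mode_times_slope[OF that])
      show "\<bar>\<Prod>i\<in>UNIV - {j}. cutoff (a $ i) (b $ i) (Suc n) (x $ i)\<bar> \<le> 1"
        unfolding abs_prod using cutoff_bounds by (intro prod_le_1) auto
    qed
    have out: "s x * wd n j x = 0" if "x \<notin> box a b" for n x
    proof -
      obtain K where "K \<subseteq> box a b" "\<forall>x. x \<notin> K \<longrightarrow> wd n j x = 0" using supp[of n j] by blast
      then have "wd n j x = 0" using that by blast
      then show ?thesis by simp
    qed
    have "(\<lambda>n. LINT x|lborel. (s x * wd n j x)\<^sup>2) \<longlonglongrightarrow> (LINT x::real^'n|lborel. (0::real))"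
    proof (rule integral_dominated_convergence[OF _ _ box_int[of "(4 * k j)\<^sup>2"]])
      show "(\<lambda>x. (s x * wd n j x)\<^sup>2) \<in> borel_measurable lborel" for n
        using err_int by (rule borel_measurable_integrable)
      show "AE x in lborel. (\<lambda>n. (s x * wd n j x)\<^sup>2) \<longlonglongrightarrow> 0"
      proof (rule AE_I2)
        fix x
        show "(\<lambda>n. (s x * wd n j x)\<^sup>2) \<longlonglongrightarrow> 0"
        proof (cases "x \<in> box a b")
          case True
          then have pos: "x $ j - a $ j > 0" "b $ j - x $ j > 0" by (auto simp: mem_box_cart)
          have "(\<lambda>n. g n x) \<longlonglongrightarrow> k j * (0 + 0)"
            unfolding g_def
            by (intro tendsto_mult tendsto_const tendsto_add
                LIMSEQ_Suc[OF slope_scaled_tendsto[OF pos(1)]] LIMSEQ_Suc[OF slope_scaled_tendsto[OF pos(2)]])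
          then have g0: "(\<lambda>n. g n x) \<longlonglongrightarrow> 0" by simp
          have "(\<lambda>n. s x * wd n j x) \<longlonglongrightarrow> 0"
            by (rule Lim_null_comparison[OF _ g0]) (simp only: real_norm_def le[OF True] eventually_True)
          from tendsto_power[OF this, of 2] show ?thesis by simp
        qed (simp add: out)
      qed
      show "AE x in lborel. norm ((s x * wd n j x)\<^sup>2) \<le> (4 * k j)\<^sup>2 * indicator (box a b) x" for n
      proof (rule AE_I2)
        fix x
        show "norm ((s x * wd n j x)\<^sup>2) \<le> (4 * k j)\<^sup>2 * indicator (box a b) x"
        proof (cases "x \<in> box a b")
          case True
          then have pos: "real (Suc n) * (x $ j - a $ j) > 0" "real (Suc n) * (b $ j - x $ j) > 0"
            by (auto simp: mem_box_cart)
          have "g n x \<le> k j * (2 + 2)"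
            unfolding g_def using slope_bounds(2)[OF pos(1)] slope_bounds(2)[OF pos(2)] k[of j]
            by (intro mult_left_mono add_mono) auto
          then have "\<bar>s x * wd n j x\<bar> \<le> 4 * k j" using le[OF True, of n] by simp
          then have "\<bar>s x * wd n j x\<bar>\<^sup>2 \<le> (4 * k j)\<^sup>2" by (intro power_mono) auto
          then show ?thesis using True by simp
        qed (simp add: out)
      qed
    qed simp
    then show ?thesis by simp
  qed

  have err_sum_lim: "(\<lambda>n. \<Sum>j\<in>UNIV. LINT x|lborel. (s x * wd n j x)\<^sup>2) \<longlonglongrightarrow> (\<Sum>j\<in>(UNIV::'n set). 0)"
    by (intro tendsto_sum err_lim)
  have "(\<lambda>n. (E - \<mu>) * (LINT x|lborel. (s x * w n x)\<^sup>2))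
      \<longlonglongrightarrow> (E - \<mu>) * (LINT x|lborel. (s x * indicator (box a b) x)\<^sup>2)"
    by (intro tendsto_mult tendsto_const mass_lim)
  from LIMSEQ_le[OF this err_sum_lim]
  have "(E - \<mu>) * (LINT x|lborel. (s x * indicator (box a b) x)\<^sup>2) \<le> (\<Sum>j\<in>(UNIV::'n set). 0)"
    using bound by blast
  moreover have "(LINT x|lborel. (s x * indicator (box a b) x)\<^sup>2) > 0"
  proof -
    have i: "integrable lborel (\<lambda>x. (s x * indicator (box a b) x)\<^sup>2)"
    proof (rule Bochner_Integration.integrable_bound[OF box_int[of 1]])
      show "(\<lambda>x. (s x * indicator (box a b) x)\<^sup>2) \<in> borel_measurable lborel"
        using borel_measurable_continuous_onI[OF s_cont] by measurable
      show "AE x in lborel. norm ((s x * indicator (box a b) x)\<^sup>2) \<le> norm (1 * indicator (box a b) x :: real)"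
        using box_mode_bounds(2)[of a b] by (auto simp: s_def indicator_def abs_square_le_1)
    qed
    have "(LINT x|lborel. (s x * indicator (box a b) x)\<^sup>2) \<noteq> 0"
    proof
      assume "(LINT x|lborel. (s x * indicator (box a b) x)\<^sup>2) = 0"
      then have "AE x in lborel. (s x * indicator (box a b) x)\<^sup>2 = 0"
        using integral_nonneg_eq_0_iff_AE[OF i] by simp
      then have "AE x in lborel. x \<notin> box a b"
        by eventually_elim (use box_mode_pos[of _ a b] in \<open>force simp: s_def indicator_def\<close>)
      then have "box a b \<in> null_sets lborel" by (simp add: AE_iff_null_sets)
      then have "negligible (box a b)"
        by (intro null_sets_completionI[THEN negligible_iff_null_sets[THEN iffD2]])
      moreover have "box a b \<noteq> {}" using ab by (auto simp: interval_ne_empty_cart)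
      ultimately show False using open_not_negligible[OF open_box] by blast
    qed
    moreover have "0 \<le> (LINT x|lborel. (s x * indicator (box a b) x)\<^sup>2)" by (rule integral_nonneg_AE) simp
    ultimately show ?thesis by linarith
  qed
  ultimately have "E \<le> \<mu>" by (simp add: mult_le_0_iff)
  then show ?thesis by (simp add: \<mu>_def k_def)
qed

section \<open>Geometry of the polyhedral layer\<close>

text \<open>The signed distance to the plane of a face, positive inside; the cylindrical inequalities in
  Cartesian coordinates.\<close>

definition face_distance :: "nat \<Rightarrow> real \<Rightarrow> nat \<Rightarrow> real^3 \<Rightarrow> real" where
  "face_distance N \<theta> j x = x $ 3 * sin \<theta>
    - cos \<theta> * (x $ 1 * cos (real j * (2 * pi / real N)) + x $ 2 * sin (real j * (2 * pi / real N)))"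

lemma polyhedral_angle_eq: "polyhedral_angle N \<theta> = {x. \<forall>j<N. face_distance N \<theta> j x > 0}"
proof -
  have cyl: "z * sin \<theta> - r * cos \<theta> * cos (\<phi> - real j * (2 * pi / real N))
      = face_distance N \<theta> j (cylindrical r \<phi> z)" for r \<phi> z j
    by (simp add: face_distance_def cylindrical_def cos_diff algebra_simps)
  have ex: "\<exists>r \<phi> z. x = cylindrical r \<phi> z \<and> r \<ge> 0" for x :: "real^3"
  proof -
    define c where "c = Complex (x $ 1) (x $ 2)"
    have "x $ 1 = cmod c * cos (Arg c)" "x $ 2 = cmod c * sin (Arg c)"
      using rcis_cmod_Arg[of c] by (simp_all add: c_def complex_eq_iff)
    then have "x = cylindrical (cmod c) (Arg c) (x $ 3)"
      by (simp add: vec_eq_iff forall_3 cylindrical_def)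
    then show ?thesis by (meson norm_ge_zero)
  qed
  show ?thesis unfolding polyhedral_angle_def cyl
  proof (intro set_eqI iffI)
    fix x assume "x \<in> {x. \<forall>j<N. face_distance N \<theta> j x > 0}"
    moreover obtain r \<phi> z where "x = cylindrical r \<phi> z" "r \<ge> 0" using ex by blast
    ultimately show "x \<in> {cylindrical r \<phi> z |r \<phi> z. 0 \<le> r \<and>
        (\<forall>j<N. 0 < face_distance N \<theta> j (cylindrical r \<phi> z))}" by blast
  qed blast
qed

lemma face_distance_lipschitz: "\<bar>face_distance N \<theta> j x - face_distance N \<theta> j y\<bar> \<le> dist x y"
proof -
  define \<alpha> where "\<alpha> = real j * (2 * pi / real N)"
  define n :: "real^3" where "n = vector [- (cos \<theta> * cos \<alpha>), - (cos \<theta> * sin \<alpha>), sin \<theta>]"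
  have "n \<bullet> n = (cos \<theta>)\<^sup>2 * (cos \<alpha>)\<^sup>2 + (cos \<theta>)\<^sup>2 * (sin \<alpha>)\<^sup>2 + (sin \<theta>)\<^sup>2"
    by (simp add: n_def inner_vec_def sum_3 power2_eq_square mult_ac)
  also have "\<dots> = (cos \<theta>)\<^sup>2 * ((cos \<alpha>)\<^sup>2 + (sin \<alpha>)\<^sup>2) + (sin \<theta>)\<^sup>2"
    by (simp only: distrib_left)
  also have "\<dots> = 1" by simp
  finally have "norm n = 1" by (simp add: norm_eq_sqrt_inner)
  have "face_distance N \<theta> j x - face_distance N \<theta> j y = n \<bullet> (x - y)"
    by (simp add: face_distance_def n_def \<alpha>_def inner_vec_def sum_3 algebra_simps)
  then show ?thesis using Cauchy_Schwarz_ineq2[of n "x - y"] \<open>norm n = 1\<close> by (simp add: dist_norm)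
qed

lemma open_polyhedral_angle: "open (polyhedral_angle N \<theta>)"
proof -
  have "polyhedral_angle N \<theta> = (\<Inter>j\<in>{..<N}. {x. face_distance N \<theta> j x > 0})"
    by (auto simp: polyhedral_angle_eq)
  moreover have "open {x. face_distance N \<theta> j x > 0}" for j
    unfolding face_distance_def by (intro open_Collect_less continuous_intros)
  ultimately show ?thesis by (simp add: open_INT)
qed

lemma open_polyhedral_layer: "open (polyhedral_layer N \<theta>)"
proof -
  let ?d = "\<lambda>x. infdist x (frontier (polyhedral_angle N \<theta>))"
  have "polyhedral_layer N \<theta> = polyhedral_angle N \<theta> \<inter> ?d -` {0<..<1}"
    by (auto simp: polyhedral_layer_def)
  moreover have "open (?d -` {0<..<1})"
    by (intro open_vimage continuous_on_infdist continuous_on_id) auto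
  ultimately show ?thesis using open_polyhedral_angle by auto
qed

text \<open>The lower boundary of the polyhedral angle as a graph over the horizontal plane.\<close>

definition bottom_height :: "nat \<Rightarrow> real \<Rightarrow> real^3 \<Rightarrow> real" where
  "bottom_height N \<theta> x = Max ((\<lambda>j. cos \<theta> / sin \<theta> * (x $ 1 * cos (real j * (2 * pi / real N))
    + x $ 2 * sin (real j * (2 * pi / real N)))) ` {..<N})"

lemma continuous_on_Max_family:
  fixes f :: "'i \<Rightarrow> 'a::topological_space \<Rightarrow> real"
  assumes "finite I" "I \<noteq> {}" "\<And>i. i \<in> I \<Longrightarrow> continuous_on S (f i)"
  shows "continuous_on S (\<lambda>x. Max ((\<lambda>i. f i x) ` I))"
  using assms by (induction I rule: finite_ne_induct) (auto intro!: continuous_on_max)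

lemma bottom_height_continuous: "N > 0 \<Longrightarrow> continuous_on UNIV (bottom_height N \<theta>)"
  unfolding bottom_height_def by (intro continuous_on_Max_family continuous_intros) auto

lemma bottom_height_vertical: "bottom_height N \<theta> (x + t *\<^sub>R axis 3 1) = bottom_height N \<theta> x"
  by (simp add: bottom_height_def axis_def)

text \<open>At the nearest boundary point some face distance is nonpositive, and face distances are
  1-Lipschitz; so some face distance at \<open>x\<close> is below \<open>1\<close>, and it grows with slope \<open>sin \<theta>\<close> in the
  vertical direction.\<close>

lemma polyhedral_layer_fibre:
  assumes N: "N > 0" and \<theta>: "\<theta> \<in> {0<..<pi/2}" and x: "x \<in> polyhedral_layer N \<theta>"
  shows "0 < x $ 3 - bottom_height N \<theta> x \<and> x $ 3 - bottom_height N \<theta> x < 1 / sin \<theta>"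
proof
  let ?A = "polyhedral_angle N \<theta>"
  define h where "h j = cos \<theta> / sin \<theta> * (x $ 1 * cos (real j * (2 * pi / real N))
    + x $ 2 * sin (real j * (2 * pi / real N)))" for j
  have s: "sin \<theta> > 0" using \<theta> by (intro sin_gt_zero) auto
  have fd: "face_distance N \<theta> j x = sin \<theta> * (x $ 3 - h j)" for j
    using s by (simp add: face_distance_def h_def algebra_simps)
  have bh: "bottom_height N \<theta> x = Max (h ` {..<N})" by (simp add: bottom_height_def h_def)
  have xA: "x \<in> ?A" and dx: "infdist x (frontier ?A) \<in> {0<..<1}"
    using x by (auto simp: polyhedral_layer_def)
  have "h j < x $ 3" if "j < N" for j
    using xA that s fd[of j] by (auto simp: polyhedral_angle_eq zero_less_mult_iff)
  then show "0 < x $ 3 - bottom_height N \<theta> x"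
    using N by (simp add: bh lessThan_empty_iff)
  have "frontier ?A \<noteq> {}" using dx by (auto simp: infdist_def)
  then obtain p where p: "p \<in> frontier ?A" "infdist x (frontier ?A) = dist x p"
    using infdist_attains_inf[OF frontier_closed] by blast
  have "p \<notin> ?A" using p(1) open_polyhedral_angle[of N \<theta>] by (simp add: frontier_def interior_open)
  then obtain j where j: "j < N" "face_distance N \<theta> j p \<le> 0" by (auto simp: polyhedral_angle_eq not_less)
  have "face_distance N \<theta> j x < 1"
    using face_distance_lipschitz[of N \<theta> j x p] j(2) p(2) dx by auto
  then have "x $ 3 - h j < 1 / sin \<theta>" using s by (simp add: fd field_simps)
  moreover have "h j \<le> bottom_height N \<theta> x" unfolding bh using j(1) by (intro Max_ge) auto
  ultimately show "x $ 3 - bottom_height N \<theta> x < 1 / sin \<theta>" by simp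
qed

lemma first_eigenvalue_layer_ge:
  assumes "N > 0" "\<theta> \<in> {0<..<pi/2}" "is_first_eigenvalue (polyhedral_layer N \<theta>) E"
  shows "pi\<^sup>2 * (sin \<theta>)\<^sup>2 \<le> E"
proof -
  have "sin \<theta> > 0" using assms(2) by (intro sin_gt_zero) auto
  then have "(pi / (1 / sin \<theta>))\<^sup>2 \<le> E"
    by (intro first_eigenvalue_ge_fibre_width[OF open_polyhedral_layer assms(3)
          bottom_height_continuous[OF assms(1)] bottom_height_vertical polyhedral_layer_fibre[OF assms(1,2)]]) auto
  then show ?thesis by (simp add: power_mult_distrib)
qed

text \<open>Near \<open>\<theta> = pi / 2\<close> the faces are almost horizontal over a bounded region. The distance to the
  boundary is below \<open>1\<close> because the vertical segment down to height \<open>- \<delta>\<close>, which is shorter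
  than \<open>1\<close>, leaves the angle.\<close>

lemma box_subset_polyhedral_layer:
  assumes N: "N > 0" and \<theta>: "\<theta> \<in> {0<..<pi/2}" and L: "2 * L * cos \<theta> < \<delta> * sin \<theta>"
  shows "box (vector [- L, - L, \<delta>]) (vector [L, L, 1 - \<delta>]) \<subseteq> polyhedral_layer N \<theta>"
proof
  fix x :: "real^3" assume "x \<in> box (vector [- L, - L, \<delta>]) (vector [L, L, 1 - \<delta>])"
  then have x: "\<bar>x $ 1\<bar> < L" "\<bar>x $ 2\<bar> < L" "\<delta> < x $ 3" "x $ 3 < 1 - \<delta>"
    by (auto simp: mem_box_cart forall_3)
  let ?A = "polyhedral_angle N \<theta>"
  have s: "sin \<theta> > 0" "cos \<theta> > 0" using \<theta> by (auto intro: sin_gt_zero cos_gt_zero)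
  have tilt: "\<bar>cos \<theta> * (x $ 1 * cos \<alpha> + x $ 2 * sin \<alpha>)\<bar> < \<delta> * sin \<theta>" for \<alpha>
  proof -
    have "\<bar>x $ 1 * cos \<alpha> + x $ 2 * sin \<alpha>\<bar> \<le> \<bar>x $ 1\<bar> * \<bar>cos \<alpha>\<bar> + \<bar>x $ 2\<bar> * \<bar>sin \<alpha>\<bar>"
      using abs_triangle_ineq[of "x $ 1 * cos \<alpha>" "x $ 2 * sin \<alpha>"] by (simp add: abs_mult)
    also have "\<dots> \<le> \<bar>x $ 1\<bar> + \<bar>x $ 2\<bar>" by (intro add_mono mult_left_le) auto
    also have "\<dots> \<le> 2 * L" using x by simp
    finally have "cos \<theta> * \<bar>x $ 1 * cos \<alpha> + x $ 2 * sin \<alpha>\<bar> \<le> cos \<theta> * (2 * L)"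
      using s by (intro mult_left_mono) auto
    also have "\<dots> = 2 * L * cos \<theta>" by simp
    also note L
    finally show ?thesis using s by (simp only: abs_mult abs_of_pos)
  qed
  have "face_distance N \<theta> j x > 0" for j
  proof -
    have "\<delta> * sin \<theta> < x $ 3 * sin \<theta>" using x s by simp
    then show ?thesis using tilt[of "real j * (2 * pi / real N)"] by (simp add: face_distance_def)
  qed
  then have xA: "x \<in> ?A" by (simp add: polyhedral_angle_eq)
  \<comment> \<open>a point straight below \<open>x\<close> at height \<open>- \<delta>\<close>\<close>
  define q where "q = x - (x $ 3 + \<delta>) *\<^sub>R axis 3 1"
  have "face_distance N \<theta> 0 q < 0"
    using tilt[of 0] by (simp add: face_distance_def q_def axis_def algebra_simps)
  then have qA: "q \<notin> ?A" using N by (force simp: polyhedral_angle_eq)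
  have pos: "\<delta> > 0"
  proof -
    have "0 < \<delta> * sin \<theta>" using tilt[of 0] by linarith
    then show ?thesis using s by (simp add: zero_less_mult_iff)
  qed
  have "closed_segment x q \<inter> ?A \<noteq> {}" "closed_segment x q - ?A \<noteq> {}" using xA qA by auto
  from connected_Int_frontier[OF connected_segment(1) this]
  obtain p where p: "p \<in> closed_segment x q" "p \<in> frontier ?A" by blast
  have "infdist x (frontier ?A) \<le> dist x p" using p(2) by (rule infdist_le)
  also have "\<dots> \<le> dist x q" using dist_in_closed_segment[OF p(1)] by (simp add: dist_commute)
  also have "\<dots> = x $ 3 + \<delta>" using x pos by (simp add: q_def dist_norm norm_axis_1)
  finally have "infdist x (frontier ?A) < 1" using x by simp
  moreover have "infdist x (frontier ?A) > 0"
  proof (rule infdist_pos_not_in_closed)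
    show "x \<notin> frontier ?A" using xA open_polyhedral_angle[of N \<theta>] by (simp add: frontier_def interior_open)
  qed (use p(2) in auto)
  ultimately show "x \<in> polyhedral_layer N \<theta>" using xA by (simp add: polyhedral_layer_def)
qed

lemma first_eigenvalue_layer_le:
  assumes "N > 0" "\<theta> \<in> {0<..<pi/2}" "is_first_eigenvalue (polyhedral_layer N \<theta>) E"
    and "0 < L" "\<delta> < 1 / 2" "2 * L * cos \<theta> < \<delta> * sin \<theta>"
  shows "E \<le> 2 * (pi / (2 * L))\<^sup>2 + (pi / (1 - 2 * \<delta>))\<^sup>2"
proof -
  have "E \<le> (\<Sum>i\<in>UNIV. (pi / ((vector [L, L, 1 - \<delta>] :: real^3) $ i - (vector [- L, - L, \<delta>] :: real^3) $ i))\<^sup>2)"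
  proof (rule first_eigenvalue_le_box[OF open_polyhedral_layer assms(3)])
    have "\<forall>i. (vector [- L, - L, \<delta>] :: real^3) $ i < (vector [L, L, 1 - \<delta>] :: real^3) $ i"
      using assms(4,5) by (simp add: forall_3)
    then show "(vector [- L, - L, \<delta>] :: real^3) $ i < (vector [L, L, 1 - \<delta>] :: real^3) $ i" for i ..
  qed (rule box_subset_polyhedral_layer[OF assms(1,2,6)])
  also have "\<dots> = 2 * (pi / (2 * L))\<^sup>2 + (pi / (1 - 2 * \<delta>))\<^sup>2"
    by (simp add: sum_3 algebra_simps)
  finally show ?thesis .
qed

theorem mainTheorem3:
  fixes N :: nat and lambda1 :: "real \<Rightarrow> real"
  assumes "N \<ge> 3"
    and "\<And>\<theta>. \<theta> \<in> {0<..<pi/2} \<Longrightarrow> is_first_eigenvalue (polyhedral_layer N \<theta>) (lambda1 \<theta>)"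
  shows "(lambda1 \<longlongrightarrow> pi\<^sup>2) (at (pi/2) within {0<..<pi/2})"
proof (rule order_tendstoI)
  let ?F = "at (pi/2) within {0<..<pi/2}"
  have N: "N > 0" using assms(1) by simp
  have inside: "\<forall>\<^sub>F \<theta> in ?F. \<theta> \<in> {0<..<pi/2}" by (simp add: eventually_at_filter)
  have sin: "(sin \<longlongrightarrow> 1) ?F" and cos: "(cos \<longlongrightarrow> 0) ?F"
    using tendsto_sin[OF tendsto_ident_at, of "pi/2"] tendsto_cos[OF tendsto_ident_at, of "pi/2"] by simp_all
  show "\<forall>\<^sub>F \<theta> in ?F. y < lambda1 \<theta>" if y: "y < pi\<^sup>2" for y
  proof -
    have "((\<lambda>\<theta>. pi\<^sup>2 * (sin \<theta>)\<^sup>2) \<longlongrightarrow> pi\<^sup>2 * 1\<^sup>2) ?F" by (intro tendsto_intros sin)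
    then have "\<forall>\<^sub>F \<theta> in ?F. y < pi\<^sup>2 * (sin \<theta>)\<^sup>2" using y by (intro order_tendstoD) auto
    with inside show ?thesis
    proof eventually_elim
      fix \<theta> assume \<theta>: "\<theta> \<in> {0<..<pi/2}" and "y < pi\<^sup>2 * (sin \<theta>)\<^sup>2"
      then show "y < lambda1 \<theta>" using first_eigenvalue_layer_ge[OF N \<theta> assms(2)[OF \<theta>]] by simp
    qed
  qed
  show "\<forall>\<^sub>F \<theta> in ?F. lambda1 \<theta> < y" if y: "pi\<^sup>2 < y" for y
  proof -
    \<comment> \<open>boxes of half-width \<open>L\<close> whose margin to the slab \<open>0 < z < 1\<close> is \<open>\<delta> = 1 / L\<close>\<close>
    have "((\<lambda>L. 2 * (pi / (2 * L))\<^sup>2 + (pi / (1 - 2 * (1 / L)))\<^sup>2) \<longlongrightarrow> pi\<^sup>2) at_top"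
      by real_asymp
    then have "\<forall>\<^sub>F L in at_top. 2 * (pi / (2 * L))\<^sup>2 + (pi / (1 - 2 * (1 / L)))\<^sup>2 < y"
      using y by (rule order_tendstoD)
    then have "\<forall>\<^sub>F L in at_top. 2 * (pi / (2 * L))\<^sup>2 + (pi / (1 - 2 * (1 / L)))\<^sup>2 < y \<and> 2 < L"
      using eventually_gt_at_top by (rule eventually_conj)
    then obtain L where L: "2 * (pi / (2 * L))\<^sup>2 + (pi / (1 - 2 * (1 / L)))\<^sup>2 < y" "2 < L"
      by (rule eventually_happens'[OF trivial_limit_at_top_linorder, THEN exE]) blast
    have "((\<lambda>\<theta>. 1 / L * sin \<theta> - 2 * L * cos \<theta>) \<longlongrightarrow> 1 / L * 1 - 2 * L * 0) ?F"
      by (intro tendsto_intros sin cos)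
    then have "\<forall>\<^sub>F \<theta> in ?F. 0 < 1 / L * sin \<theta> - 2 * L * cos \<theta>"
      by (rule order_tendstoD) (use L in simp)
    with inside show ?thesis
    proof eventually_elim
      fix \<theta> assume \<theta>: "\<theta> \<in> {0<..<pi/2}" and t: "0 < 1 / L * sin \<theta> - 2 * L * cos \<theta>"
      have "lambda1 \<theta> \<le> 2 * (pi / (2 * L))\<^sup>2 + (pi / (1 - 2 * (1 / L)))\<^sup>2"
        using L(2) t by (intro first_eigenvalue_layer_le[OF N \<theta> assms(2)[OF \<theta>]]) auto
      then show "lambda1 \<theta> < y" using L(1) by simp
    qed
  qed
qed

end
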